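(* If $\varphi:\mathcal A\to M_m(\mathbb C)$ is a unital linear isometry, then $m\ge n$. If, in addition, the C$^*$-envelope $C^*_e(\varphi(\mathcal A))$ is $*$-isomorphic to $M_n(\mathbb C)$, then there are a unitary $U\in M_m(\mathbb C)$, a positive integer $\ell$, and a unital linear contraction $\psi:\mathcal A\to M_{m-\ell n}(\mathbb C)$ such that $$\varphi(X)=U\big((X\otimes I_\ell)\oplus\psi(X)\big)U^*\quad\text{for every }X\in\mathcal A,$$ where $X\otimes I_\ell$ denotes the direct sum of $\ell$ copies of $X$.
   Context: $S$ denotes the $n\times n$ nilpotent Jordan block with ones on the superdiagonal and zeros elsewhere. $\mathcal A=\{f(S): f\text{ a complex polynomial}\}$ is the algebra of $n\times n$ upper-triangular Toeplitz matrices. Matrix algebras carry the operator norm induced by the Euclidean norm; a linear isometry satisfies $\|\varphi(X)\|=\|X\|$; unital means $\varphi(I)=I$. For a unital subspace $\mathcal S$ of a matrix algebra, its C$^*$-envelope $C^*_e(\mathcal S)$ is the unital C$^*$-algebra (unique up to isomorphism) with a unital complete isometry $\iota:\mathcal S\to C^*_e(\mathcal S)$ whose image generates $C^*_e(\mathcal S)$, such that for every unital complete isometry $\kappa$ of $\mathcal S$ into some $B(H)$ there is a surjective unital $*$-homomorphism $\pi$ from the C$^*$-algebra generated by $\kappa(\mathcal S)$ onto $C^*_e(\mathcal S)$ with $\pi\circ\kappa=\iota$. *)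

theory Defs
  imports "Jordan_Normal_Form.Matrix" "HOL-Computational_Algebra.Polynomial"
begin

definition vnorm :: "complex vec \<Rightarrow> real" where
  "vnorm v = sqrt (\<Sum>i<dim_vec v. (cmod (v $ i))^2)"

definition opnorm :: "complex mat \<Rightarrow> real" where
  "opnorm A = Sup {vnorm (A *\<^sub>v v) | v. v \<in> carrier_vec (dim_col A) \<and> vnorm v \<le> 1}"

definition adj :: "complex mat \<Rightarrow> complex mat" where
  "adj A = mat (dim_col A) (dim_row A) (\<lambda>(i,j). cnj (A $$ (j,i)))"

definition unitary_mat :: "nat \<Rightarrow> complex mat \<Rightarrow> bool" where
  "unitary_mat m U \<longleftrightarrow> U \<in> carrier_mat m m \<and> adj U * U = 1\<^sub>m m \<and> U * adj U = 1\<^sub>m m"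

definition jordan_shift :: "nat \<Rightarrow> complex mat" where
  "jordan_shift n = mat n n (\<lambda>(i,j). if j = Suc i then 1 else 0)"

definition poly_eval_mat :: "complex poly \<Rightarrow> complex mat \<Rightarrow> complex mat" where
  "poly_eval_mat f A =
     mat (dim_row A) (dim_col A) (\<lambda>(i,j). \<Sum>k\<le>degree f. coeff f k * (A ^\<^sub>m k) $$ (i,j))"

definition toeplitz_alg :: "nat \<Rightarrow> complex mat set" where
  "toeplitz_alg n = {poly_eval_mat f (jordan_shift n) | f. True}"

definition unital_linear_on :: "complex mat set \<Rightarrow> nat \<Rightarrow> nat \<Rightarrow> (complex mat \<Rightarrow> complex mat) \<Rightarrow> bool" where
  "unital_linear_on S d k \<phi> \<longleftrightarrow>
     \<phi> (1\<^sub>m d) = 1\<^sub>m k \<and>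
     (\<forall>X\<in>S. \<phi> X \<in> carrier_mat k k) \<and>
     (\<forall>X\<in>S. \<forall>Y\<in>S. \<phi> (X + Y) = \<phi> X + \<phi> Y) \<and>
     (\<forall>c. \<forall>X\<in>S. \<phi> (c \<cdot>\<^sub>m X) = c \<cdot>\<^sub>m \<phi> X)"

definition block_mat :: "nat \<Rightarrow> nat \<Rightarrow> (nat \<Rightarrow> nat \<Rightarrow> complex mat) \<Rightarrow> complex mat" where
  "block_mat d p F = mat (d * p) (d * p) (\<lambda>(i,j). F (i div d) (j div d) $$ (i mod d, j mod d))"

definition complete_isometry_on :: "complex mat set \<Rightarrow> nat \<Rightarrow> nat \<Rightarrow> (complex mat \<Rightarrow> complex mat) \<Rightarrow> bool" where
  "complete_isometry_on S d k \<kappa> \<longleftrightarrow>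
     (\<forall>p F. (\<forall>i<p. \<forall>j<p. F i j \<in> S) \<longrightarrow>
        opnorm (block_mat k p (\<lambda>i j. \<kappa> (F i j))) = opnorm (block_mat d p F))"

inductive_set cstar_gen :: "nat \<Rightarrow> complex mat set \<Rightarrow> complex mat set" for k T where
  gen: "X \<in> T \<Longrightarrow> X \<in> cstar_gen k T"
| one: "1\<^sub>m k \<in> cstar_gen k T"
| add: "X \<in> cstar_gen k T \<Longrightarrow> Y \<in> cstar_gen k T \<Longrightarrow> X + Y \<in> cstar_gen k T"
| smult: "X \<in> cstar_gen k T \<Longrightarrow> c \<cdot>\<^sub>m X \<in> cstar_gen k T"
| mult: "X \<in> cstar_gen k T \<Longrightarrow> Y \<in> cstar_gen k T \<Longrightarrow> X * Y \<in> cstar_gen k T"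
| adjoint: "X \<in> cstar_gen k T \<Longrightarrow> adj X \<in> cstar_gen k T"

definition star_hom_onto :: "complex mat set \<Rightarrow> nat \<Rightarrow> nat \<Rightarrow> (complex mat \<Rightarrow> complex mat) \<Rightarrow> bool" where
  "star_hom_onto B k n \<pi> \<longleftrightarrow>
     \<pi> (1\<^sub>m k) = 1\<^sub>m n \<and>
     (\<forall>X\<in>B. \<forall>Y\<in>B. \<pi> (X + Y) = \<pi> X + \<pi> Y) \<and>
     (\<forall>c. \<forall>X\<in>B. \<pi> (c \<cdot>\<^sub>m X) = c \<cdot>\<^sub>m \<pi> X) \<and>
     (\<forall>X\<in>B. \<forall>Y\<in>B. \<pi> (X * Y) = \<pi> X * \<pi> Y) \<and>
     (\<forall>X\<in>B. \<pi> (adj X) = adj (\<pi> X)) \<and>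
     \<pi> ` B = carrier_mat n n"

text \<open>The C*-envelope of the unital subspace S of M_d is *-isomorphic to M_n:
  M_n together with some unital complete isometry iota of S into M_n, whose image
  generates M_n, has the universal property of the C*-envelope (tested against
  unital complete isometries of S into matrix algebras M_k).\<close>
definition cstar_envelope_iso_Mn :: "complex mat set \<Rightarrow> nat \<Rightarrow> nat \<Rightarrow> bool" where
  "cstar_envelope_iso_Mn S d n \<longleftrightarrow>
     (\<exists>\<iota>. unital_linear_on S d n \<iota> \<and> complete_isometry_on S d n \<iota> \<and>
          cstar_gen n (\<iota> ` S) = carrier_mat n n \<and>
          (\<forall>k \<kappa>. unital_linear_on S d k \<kappa> \<and> complete_isometry_on S d k \<kappa> \<longrightarrow>
             (\<exists>\<pi>. star_hom_onto (cstar_gen k (\<kappa> ` S)) k n \<pi> \<and>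
                  (\<forall>X\<in>S. \<pi> (\<kappa> X) = \<iota> X))))"

end

theory Submission
  imports Defs "Jordan_Normal_Form.Determinant" "HOL-Analysis.Function_Topology"
begin

text \<open>
  A unital isometry between spaces of matrices preserves nonnegativity of the real part, since
  \<open>Re X \<ge> 0\<close> can be read off from the growth of \<open>\<parallel>I - t X\<parallel>\<close> as \<open>t\<close> tends to 0 from the right.
  For \<open>\<bar>z\<bar> = 1\<close> the projection \<open>E\<^sub>z\<close> onto the span of \<open>(1, z, \<dots>, z\<^sup>n\<^sup>-\<^sup>1)\<close> is the real part of some \<open>X\<^sub>z\<close> in the algebra,
  so \<open>H\<^sub>z = Re \<phi>(X\<^sub>z)\<close> satisfies \<open>0 \<le> H\<^sub>z \<le> I\<close> and has the eigenvalue 1. When \<open>z\<close> runs through the \<open>n\<close>-th roots of a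
  unimodular number \<open>\<omega>\<close>, the \<open>H\<^sub>z\<close> add up to \<open>I\<close>; hence the fixed vectors of the \<open>n\<close> matrices \<open>H\<^sub>z\<close> are orthonormal, and
  \<open>n \<le> m\<close>.

  If \<open>m = n\<close>, these vectors form a basis of common eigenvectors of the matrices \<open>\<phi>(S\<^sup>k) + \<omega> \<phi>(S\<^sup>n\<^sup>-\<^sup>k)\<^sup>*\<close>, which
  therefore are the powers of the one for \<open>k = 1\<close>. Comparing coefficients in \<open>\<omega>\<close> shows that \<open>\<phi>(S)\<close> is a nilpotent
  contraction with powers \<open>\<phi>(S\<^sup>k)\<close>. A unit vector at which \<open>\<phi>(S)\<^sup>n\<^sup>-\<^sup>1\<close> attains its norm 1 has an orthonormal
  orbit, so \<open>\<phi>\<close> is unitarily equivalent to the identity representation.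

  In general the envelope hypothesis gives a *-homomorphism \<open>\<pi>\<close> from the generated algebra onto \<open>M\<^sub>n\<close> such that
  \<open>\<pi> \<circ> \<phi>\<close> is an isometry into \<open>M\<^sub>n\<close>. An element of minimal rank among those not in the kernel of \<open>\<pi>\<close> is annihilated by
  the kernel, and this produces a unit vector \<open>w\<close> with \<open>\<langle>d w, w\<rangle> = \<pi>(d)\<^sub>0\<^sub>0\<close> for all \<open>d\<close>. Lifts of the matrix units
  applied to \<open>w\<close> span a reducing subspace on which the algebra acts through \<open>\<pi>\<close>; a single copy (\<open>\<ell> = 1\<close>) suffices,
  as the rest of the space is absorbed into the compression \<open>\<psi>\<close>.
\<close>

section \<open>Matrices, norms and orthonormal families\<close>

text \<open>The standard inner product, linear in the first argument and conjugate-linear in the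
  second. The index range is read off the second vector, so the rules below carry carrier
  assumptions.\<close>

definition ip :: "complex vec \<Rightarrow> complex vec \<Rightarrow> complex" where
  "ip v w = (\<Sum>i<dim_vec w. v $ i * cnj (w $ i))"

lemma mult_mat_vec_index:
  assumes "A \<in> carrier_mat r m" "v \<in> carrier_vec m" "i < r"
  shows "(A *\<^sub>v v) $ i = (\<Sum>j<m. A $$ (i,j) * v $ j)"
  using assms by (auto simp: scalar_prod_def atLeast0LessThan intro!: sum.cong)

lemma mult_mat_index:
  assumes "A \<in> carrier_mat r m" "B \<in> carrier_mat m k" "i < r" "j < k"
  shows "(A * B) $$ (i,j) = (\<Sum>l<m. A $$ (i,l) * B $$ (l,j))"
  using assms by (auto simp: scalar_prod_def atLeast0LessThan intro!: sum.cong)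

lemma adj_carrier[simp, intro]: "A \<in> carrier_mat r m \<Longrightarrow> adj A \<in> carrier_mat m r"
  by (auto simp: adj_def)

lemma dim_adj[simp]: "dim_row (adj A) = dim_col A" "dim_col (adj A) = dim_row A"
  by (auto simp: adj_def)

lemma adj_index[simp]: "i < dim_col A \<Longrightarrow> j < dim_row A \<Longrightarrow> adj A $$ (i,j) = cnj (A $$ (j,i))"
  by (auto simp: adj_def)

lemma adj_adj[simp]: "adj (adj A) = A"
  by (rule eq_matI) auto

lemma adj_mult:
  assumes "A \<in> carrier_mat r m" "B \<in> carrier_mat m k"
  shows "adj (A * B) = adj B * adj A"
proof (rule eq_matI)
  fix i j assume "i < dim_row (adj B * adj A)" "j < dim_col (adj B * adj A)"
  then have ij: "i < k" "j < r" using assms by auto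
  have "adj (A * B) $$ (i,j) = cnj (\<Sum>l<m. A $$ (j,l) * B $$ (l,i))"
    using assms ij by (subst mult_mat_index[symmetric, of A r m B k]) auto
  also have "\<dots> = (\<Sum>l<m. adj B $$ (i,l) * adj A $$ (l,j))"
    using assms ij by (auto intro!: sum.cong)
  also have "\<dots> = (adj B * adj A) $$ (i,j)"
    using assms ij by (subst mult_mat_index[of _ k m _ r]) auto
  finally show "adj (A * B) $$ (i,j) = (adj B * adj A) $$ (i,j)" .
qed (use assms in auto)

lemma ip_add_left: "u \<in> carrier_vec m \<Longrightarrow> v \<in> carrier_vec m \<Longrightarrow> w \<in> carrier_vec m \<Longrightarrow>
    ip (u + v) w = ip u w + ip v w"
  by (simp add: ip_def sum.distrib algebra_simps)

lemma ip_add_right: "u \<in> carrier_vec m \<Longrightarrow> v \<in> carrier_vec m \<Longrightarrow> w \<in> carrier_vec m \<Longrightarrow>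
    ip u (v + w) = ip u v + ip u w"
  by (simp add: ip_def sum.distrib algebra_simps)

lemma ip_smult_left: "u \<in> carrier_vec m \<Longrightarrow> v \<in> carrier_vec m \<Longrightarrow> ip (c \<cdot>\<^sub>v u) v = c * ip u v"
  by (simp add: ip_def sum_distrib_left algebra_simps)

lemma ip_smult_right: "u \<in> carrier_vec m \<Longrightarrow> v \<in> carrier_vec m \<Longrightarrow> ip u (c \<cdot>\<^sub>v v) = cnj c * ip u v"
  by (simp add: ip_def sum_distrib_left algebra_simps)

lemma ip_cnj: "u \<in> carrier_vec m \<Longrightarrow> v \<in> carrier_vec m \<Longrightarrow> cnj (ip u v) = ip v u"
  by (auto simp: ip_def algebra_simps intro!: sum.cong)

lemma ip_zero_left[simp]: "v \<in> carrier_vec m \<Longrightarrow> ip (0\<^sub>v m) v = 0"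
  by (simp add: ip_def)

lemma ip_zero_right[simp]: "v \<in> carrier_vec m \<Longrightarrow> ip v (0\<^sub>v m) = 0"
  by (simp add: ip_def)

lemmas ip_simps = ip_add_left ip_add_right ip_smult_left ip_smult_right

lemma ip_adj:
  assumes A: "A \<in> carrier_mat r m" and v: "v \<in> carrier_vec m" and w: "w \<in> carrier_vec r"
  shows "ip (A *\<^sub>v v) w = ip v (adj A *\<^sub>v w)"
proof -
  have "ip (A *\<^sub>v v) w = (\<Sum>i<r. \<Sum>j<m. A $$ (i,j) * v $ j * cnj (w $ i))"
    using A w by (auto simp: ip_def mult_mat_vec_index[OF A v] sum_distrib_right simp del: index_mult_mat_vec)
  also have "\<dots> = (\<Sum>j<m. \<Sum>i<r. A $$ (i,j) * v $ j * cnj (w $ i))"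
    by (rule sum.swap)
  also have "\<dots> = ip v (adj A *\<^sub>v w)"
    using A v w by (auto simp: ip_def mult_mat_vec_index[OF adj_carrier[OF A] w] sum_distrib_left mult_ac
         simp del: index_mult_mat_vec intro!: sum.cong)
  finally show ?thesis .
qed

lemma vnorm_nonneg[simp]: "0 \<le> vnorm v"
  by (simp add: vnorm_def sum_nonneg)

lemma vnorm_square: "(vnorm v)\<^sup>2 = Re (ip v v)"
  by (simp add: vnorm_def ip_def sum_nonneg complex_mult_cnj cmod_power2)

lemma ip_self: "ip v v = complex_of_real ((vnorm v)\<^sup>2)"
proof -
  have "ip v v = complex_of_real (\<Sum>i<dim_vec v. (cmod (v $ i))\<^sup>2)"
    unfolding ip_def of_real_sum by (rule sum.cong) (auto simp: complex_norm_square[symmetric])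
  then show ?thesis by (simp add: vnorm_def sum_nonneg)
qed

lemma vnorm_eq_0_iff: "v \<in> carrier_vec m \<Longrightarrow> vnorm v = 0 \<longleftrightarrow> v = 0\<^sub>v m"
  by (auto simp: vnorm_def sum_nonneg_eq_0_iff intro!: eq_vecI)

lemma vnorm_smult: "vnorm (c \<cdot>\<^sub>v v) = cmod c * vnorm v"
  by (simp add: vnorm_def norm_mult power_mult_distrib sum_distrib_left[symmetric] real_sqrt_mult)

lemma vnorm_zero[simp]: "vnorm (0\<^sub>v m) = 0"
  by (simp add: vnorm_def)

lemma vnorm_normalize:
  assumes "v \<in> carrier_vec m" "v \<noteq> 0\<^sub>v m"
  shows "vnorm (complex_of_real (1 / vnorm v) \<cdot>\<^sub>v v) = 1"
  using vnorm_eq_0_iff[OF assms(1)] assms(2) by (simp add: vnorm_smult del: of_real_divide)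

lemma vnorm_pythagoras:
  assumes "u \<in> carrier_vec m" "v \<in> carrier_vec m"
  shows "(vnorm (u + v))\<^sup>2 = (vnorm u)\<^sup>2 + 2 * Re (ip u v) + (vnorm v)\<^sup>2"
proof -
  have "Re (ip v u) = Re (ip u v)" using ip_cnj[OF assms] by (metis cnj.sel(1))
  then show ?thesis using assms by (simp add: vnorm_square ip_simps)
qed

lemma cauchy_schwarz:
  assumes u: "u \<in> carrier_vec m" and v: "v \<in> carrier_vec m"
  shows "cmod (ip u v) \<le> vnorm u * vnorm v"
proof (cases "vnorm v = 0")
  case True
  then have "v = 0\<^sub>v m" using vnorm_eq_0_iff[OF v] by simp
  then show ?thesis using u by simp
next
  case False
  \<comment> \<open>\<open>c\<close> is the coefficient of the orthogonal projection of
    \<open>u\<close> onto \<open>v\<close>; the inequality is nonnegativity of the squared distance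
    of \<open>u\<close> from that projection.\<close>
  define c where "c = ip u v / complex_of_real ((vnorm v)\<^sup>2)"
  have "0 \<le> (vnorm (u + (- c) \<cdot>\<^sub>v v))\<^sup>2" by simp
  also have "\<dots> = (vnorm u)\<^sup>2 - 2 * Re (cnj c * ip u v) + (cmod c)\<^sup>2 * (vnorm v)\<^sup>2"
    using u v by (simp add: vnorm_pythagoras[of _ m] ip_smult_right[of _ m] vnorm_smult power_mult_distrib)
  also have "cnj c * ip u v = complex_of_real ((cmod (ip u v))\<^sup>2 / (vnorm v)\<^sup>2)"
    unfolding c_def by (simp add: complex_norm_square[symmetric] mult.commute)
  also have "(cmod c)\<^sup>2 * (vnorm v)\<^sup>2 = (cmod (ip u v))\<^sup>2 / (vnorm v)\<^sup>2"
    using False unfolding c_def by (simp add: norm_divide power_divide norm_mult norm_power power2_eq_square)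
  finally have "(cmod (ip u v))\<^sup>2 / (vnorm v)\<^sup>2 \<le> (vnorm u)\<^sup>2" by simp
  then have "(cmod (ip u v))\<^sup>2 \<le> (vnorm u * vnorm v)\<^sup>2"
    using False by (simp add: field_simps power_mult_distrib)
  then show ?thesis by (rule power2_le_imp_le) simp
qed

section \<open>Finiteness and basic estimates of the operator norm\<close>

lemma vnorm_mult_mat_vec_bound:
  assumes A: "A \<in> carrier_mat r m"
  shows "\<exists>C. \<forall>v\<in>carrier_vec m. vnorm (A *\<^sub>v v) \<le> C * vnorm v"
proof -
  \<comment> \<open>\<open>D\<close> is the squared Frobenius norm. The rows are conjugated so that
    each coordinate of \<open>A *\<^sub>v v\<close> is an inner product of \<open>v\<close> with a
    row.\<close>
  define D where "D = (\<Sum>i<r. (vnorm (vec m (\<lambda>j. cnj (A $$ (i,j)))))\<^sup>2)"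
  have "vnorm (A *\<^sub>v v) \<le> sqrt D * vnorm v" if v: "v \<in> carrier_vec m" for v
  proof -
    have "(vnorm (A *\<^sub>v v))\<^sup>2 = (\<Sum>i<r. (cmod (ip v (vec m (\<lambda>j. cnj (A $$ (i,j))))))\<^sup>2)"
      using A v by (auto simp: vnorm_def sum_nonneg mult_mat_vec_index[OF A v] ip_def mult.commute
          simp del: index_mult_mat_vec intro!: sum.cong)
    also have "\<dots> \<le> (\<Sum>i<r. (vnorm v * vnorm (vec m (\<lambda>j. cnj (A $$ (i,j)))))\<^sup>2)"
      using v by (intro sum_mono power_mono cauchy_schwarz) auto
    also have "\<dots> = D * (vnorm v)\<^sup>2"
      by (simp add: D_def power_mult_distrib sum_distrib_left mult.commute)
    finally have "(vnorm (A *\<^sub>v v))\<^sup>2 \<le> (sqrt D * vnorm v)\<^sup>2"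
      by (simp add: power_mult_distrib D_def sum_nonneg)
    then show ?thesis by (rule power2_le_imp_le) (simp add: D_def sum_nonneg)
  qed
  then show ?thesis by blast
qed

text \<open>The real supremum in \<open>opnorm\<close> can only be used as an upper bound once its
  set is known to be bounded; the Frobenius estimate provides this.\<close>

lemma opnorm_bdd:
  assumes A: "A \<in> carrier_mat r m"
  shows "bdd_above {vnorm (A *\<^sub>v v) | v. v \<in> carrier_vec (dim_col A) \<and> vnorm v \<le> 1}"
proof -
  obtain C where C: "\<forall>v\<in>carrier_vec m. vnorm (A *\<^sub>v v) \<le> C * vnorm v"
    using vnorm_mult_mat_vec_bound[OF A] by blast
  show ?thesis
  proof (rule bdd_aboveI[of _ "\<bar>C\<bar>"], clarify)
    fix v assume v: "v \<in> carrier_vec (dim_col A)" "vnorm v \<le> 1"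
    then have "vnorm (A *\<^sub>v v) \<le> C * vnorm v" using C A by auto
    also have "\<dots> \<le> \<bar>C\<bar> * 1" using v by (intro mult_mono) auto
    finally show "vnorm (A *\<^sub>v v) \<le> \<bar>C\<bar>" by simp
  qed
qed

lemma opnorm_nonneg:
  assumes A: "A \<in> carrier_mat r m"
  shows "0 \<le> opnorm A"
proof -
  have "vnorm (A *\<^sub>v 0\<^sub>v m) \<le> opnorm A"
    unfolding opnorm_def using A by (intro cSup_upper opnorm_bdd) auto
  then show ?thesis using vnorm_nonneg order_trans by blast
qed

lemma vnorm_mult_le_opnorm:
  assumes A: "A \<in> carrier_mat r m" and v: "v \<in> carrier_vec m"
  shows "vnorm (A *\<^sub>v v) \<le> opnorm A * vnorm v"
proof (cases "v = 0\<^sub>v m")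
  case True
  then show ?thesis using A vnorm_zero[of r] by (auto simp: vnorm_def)
next
  case False
  let ?c = "complex_of_real (1 / vnorm v)"
  have n0: "vnorm v > 0" using vnorm_eq_0_iff[OF v] False vnorm_nonneg[of v] by linarith
  have "vnorm (A *\<^sub>v (?c \<cdot>\<^sub>v v)) \<le> opnorm A"
    unfolding opnorm_def using A v vnorm_normalize[OF v False]
    by (intro cSup_upper opnorm_bdd) auto
  then have "vnorm (A *\<^sub>v v) / vnorm v \<le> opnorm A"
    using A v n0 by (simp add: mult_mat_vec[OF A v] vnorm_smult norm_divide)
  then show ?thesis using n0 by (simp add: field_simps)
qed

lemma opnorm_le:
  assumes A: "A \<in> carrier_mat r m" and c: "0 \<le> c"
    and le: "\<And>v. v \<in> carrier_vec m \<Longrightarrow> vnorm (A *\<^sub>v v) \<le> c * vnorm v"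
  shows "opnorm A \<le> c"
  unfolding opnorm_def
proof (rule cSup_least)
  show "{vnorm (A *\<^sub>v v) |v. v \<in> carrier_vec (dim_col A) \<and> vnorm v \<le> 1} \<noteq> {}"
    using A by (auto intro!: exI[of _ "0\<^sub>v m"])
  fix x assume "x \<in> {vnorm (A *\<^sub>v v) |v. v \<in> carrier_vec (dim_col A) \<and> vnorm v \<le> 1}"
  then obtain v where v: "x = vnorm (A *\<^sub>v v)" "v \<in> carrier_vec m" "vnorm v \<le> 1" using A by auto
  then have "x \<le> c * vnorm v" using le by auto
  also have "\<dots> \<le> c" using v c by (simp add: mult_left_le)
  finally show "x \<le> c" .
qed

section \<open>Orthonormal families, their matrices and their extension to bases\<close>

definition orthonormal_family :: "nat \<Rightarrow> nat \<Rightarrow> (nat \<Rightarrow> complex vec) \<Rightarrow> bool" where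
  "orthonormal_family m k e \<longleftrightarrow> (\<forall>i<k. e i \<in> carrier_vec m) \<and> (\<forall>i<k. \<forall>j<k. ip (e i) (e j) = (if i = j then 1 else 0))"

definition mat_of_family :: "nat \<Rightarrow> nat \<Rightarrow> (nat \<Rightarrow> complex vec) \<Rightarrow> complex mat" where
  "mat_of_family m k e = mat m k (\<lambda>(i,j). e j $ i)"

lemma mat_of_family_carrier[simp, intro]: "mat_of_family m k e \<in> carrier_mat m k"
  by (simp add: mat_of_family_def)

lemma dim_mat_of_family[simp]:
  "dim_row (mat_of_family m k e) = m" "dim_col (mat_of_family m k e) = k"
  by (auto simp: mat_of_family_def)

text \<open>Identifies the compression of \<open>A\<close> to a family with the values of its
  sesquilinear form; the column index belongs to the vector that \<open>A\<close> acts on. For the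
  identity matrix this is the Gram matrix.\<close>

lemma adj_mat_of_family_mult:
  assumes e: "\<And>i. i < k \<Longrightarrow> e i \<in> carrier_vec m" and A: "A \<in> carrier_mat m m" and ij: "i < k" "j < k"
  shows "(adj (mat_of_family m k e) * (A * mat_of_family m k e)) $$ (i,j) = ip (A *\<^sub>v e j) (e i)"
proof -
  let ?E = "mat_of_family m k e"
  have E: "?E \<in> carrier_mat m k" by simp
  have "(adj ?E * (A * ?E)) $$ (i,j) = (\<Sum>l<m. cnj (e i $ l) * (A * ?E) $$ (l,j))"
    using A ij by (subst mult_mat_index[of _ k m _ k]) (auto simp: mat_of_family_def intro!: sum.cong)
  also have "\<dots> = (\<Sum>l<m. (A *\<^sub>v e j) $ l * cnj (e i $ l))"
    using A ij e[OF ij(2)]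
    by (intro sum.cong refl, subst mult_mat_index[OF A E]) (auto simp: mat_of_family_def mult_mat_vec_index[OF A e[OF ij(2)]] simp del: index_mult_mat_vec)
  also have "\<dots> = ip (A *\<^sub>v e j) (e i)" using e[OF ij(1)] by (simp add: ip_def)
  finally show ?thesis .
qed

lemma adj_mat_of_family_self:
  assumes "orthonormal_family m k e"
  shows "adj (mat_of_family m k e) * mat_of_family m k e = 1\<^sub>m k"
proof (rule eq_matI)
  fix i j assume "i < dim_row (1\<^sub>m k :: complex mat)" "j < dim_col (1\<^sub>m k :: complex mat)"
  then have "i < k" "j < k" by auto
  then show "(adj (mat_of_family m k e) * mat_of_family m k e) $$ (i,j) = 1\<^sub>m k $$ (i,j)"
    using assms adj_mat_of_family_mult[of k e m "1\<^sub>m m" i j] by (auto simp: orthonormal_family_def left_mult_one_mat[of _ m k])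
qed (auto simp: mat_of_family_def)

text \<open>If \<open>k\<close> exceeded \<open>m\<close>, padding the vectors with zeros up to
  length \<open>k\<close> would give a square matrix with orthonormal columns, hence a unitary one,
  although its row \<open>m\<close> vanishes.\<close>

lemma orthonormal_card_le:
  assumes e: "orthonormal_family m k e"
  shows "k \<le> m"
proof (rule ccontr)
  assume "\<not> k \<le> m"
  then have mk: "m < k" by simp
  define f where "f i = vec k (\<lambda>r. if r < m then e i $ r else 0)" for i
  have "orthonormal_family k k f"
    unfolding orthonormal_family_def
  proof (intro conjI allI impI)
    fix i j assume ij: "i < k" "j < k"
    have "ip (f i) (f j) = (\<Sum>r<k. if r < m then e i $ r * cnj (e j $ r) else 0)"
      unfolding ip_def f_def by (auto intro!: sum.cong)
    also have "\<dots> = (\<Sum>r<m. e i $ r * cnj (e j $ r))"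
      using mk by (intro sum.mono_neutral_cong_right) auto
    also have "\<dots> = ip (e i) (e j)" using e ij(2) unfolding ip_def by (auto simp: orthonormal_family_def)
    finally show "ip (f i) (f j) = (if i = j then 1 else 0)" using e ij by (simp add: orthonormal_family_def)
  qed (simp add: f_def)
  then have "adj (mat_of_family k k f) * mat_of_family k k f = 1\<^sub>m k"
    by (rule adj_mat_of_family_self)
  then have "mat_of_family k k f * adj (mat_of_family k k f) = 1\<^sub>m k"
    by (rule mat_mult_left_right_inverse[rotated 2]) auto
  then have "(mat_of_family k k f * adj (mat_of_family k k f)) $$ (m,m) = 1" using mk by simp
  then show False using mk
    by (subst (asm) mult_mat_index[of _ k k _ k]) (auto simp: mat_of_family_def f_def)
qed

lemma orthonormal_unitary:
  assumes e: "orthonormal_family m m e"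
  shows "unitary_mat m (mat_of_family m m e)"
  using adj_mat_of_family_self[OF e]
    mat_mult_left_right_inverse[of "adj (mat_of_family m m e)" m, OF _ _ adj_mat_of_family_self[OF e]]
  by (auto simp: unitary_mat_def)

lemma mat_of_family_mult_vec_ip:
  assumes e: "\<And>i. i < k \<Longrightarrow> e i \<in> carrier_vec m" and v: "v \<in> carrier_vec m" and i: "i < k"
  shows "(adj (mat_of_family m k e) *\<^sub>v v) $ i = ip v (e i)"
  using e[OF i] v i by (subst mult_mat_vec_index[of _ k m])
    (auto simp: mat_of_family_def ip_def mult.commute intro!: sum.cong)

lemma mult_mat_of_family_zero:
  assumes e: "\<And>i. i < k \<Longrightarrow> e i \<in> carrier_vec m" and A: "A \<in> carrier_mat r m"
    and 0: "\<And>i. i < k \<Longrightarrow> A *\<^sub>v e i = 0\<^sub>v r"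
  shows "A * mat_of_family m k e = 0\<^sub>m r k"
proof (rule eq_matI)
  fix i j assume "i < dim_row (0\<^sub>m r k :: complex mat)" "j < dim_col (0\<^sub>m r k :: complex mat)"
  then have ij: "i < r" "j < k" by auto
  have "(A * mat_of_family m k e) $$ (i,j) = (A *\<^sub>v e j) $ i"
    using ij A e[OF ij(2)] by (subst mult_mat_index[of _ r m _ k], auto simp del: index_mult_mat_vec,
        subst mult_mat_vec_index[of _ r m]) (auto simp: mat_of_family_def)
  then show "(A * mat_of_family m k e) $$ (i,j) = 0\<^sub>m r k $$ (i,j)" using 0 ij by simp
qed (use A in \<open>auto simp: mat_of_family_def\<close>)

text \<open>One Gram-Schmidt step. The new vector is a combination of \<open>v\<close> and the old
  ones, which is what the second conclusion records: a matrix that kills these kills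
  \<open>w\<close>. This is used later to enlarge null spaces.\<close>

lemma orthonormal_extend:
  assumes e: "orthonormal_family m k e" and v: "v \<in> carrier_vec m"
    and ne: "v \<noteq> mat_of_family m k e *\<^sub>v (adj (mat_of_family m k e) *\<^sub>v v)"
  obtains w where "orthonormal_family m (Suc k) (e(k := w))"
    and "\<And>A r. A \<in> carrier_mat r m \<Longrightarrow> A *\<^sub>v v = 0\<^sub>v r \<Longrightarrow> (\<And>i. i < k \<Longrightarrow> A *\<^sub>v e i = 0\<^sub>v r) \<Longrightarrow> A *\<^sub>v w = 0\<^sub>v r"
proof -
  let ?E = "mat_of_family m k e"
  have E: "?E \<in> carrier_mat m k" "adj ?E \<in> carrier_mat k m" by auto
  have ec: "\<And>i. i < k \<Longrightarrow> e i \<in> carrier_vec m" using e by (auto simp: orthonormal_family_def)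
  define y where "y = adj ?E *\<^sub>v v"
  have y: "y \<in> carrier_vec k" "?E *\<^sub>v y \<in> carrier_vec m" using E v by (auto simp: y_def intro!: mult_mat_vec_carrier)
  \<comment> \<open>The component of \<open>v\<close> orthogonal to the span of the family.\<close>
  define x where "x = v - ?E *\<^sub>v y"
  have x: "x \<in> carrier_vec m" using v y by (auto simp: x_def)
  have x0: "x \<noteq> 0\<^sub>v m"
  proof
    assume "x = 0\<^sub>v m"
    then have "v $ i - (?E *\<^sub>v y) $ i = 0" if "i < m" for i
      using that v y unfolding x_def by (metis carrier_vecD index_minus_vec(1) index_zero_vec(1))
    then have "v = ?E *\<^sub>v y" using v y by (intro eq_vecI) auto
    then show False using ne by (simp add: y_def)
  qed
  define w where "w = complex_of_real (1 / vnorm x) \<cdot>\<^sub>v x"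
  have w: "w \<in> carrier_vec m" using x by (simp add: w_def)
  have "adj ?E *\<^sub>v x = adj ?E *\<^sub>v v - adj ?E *\<^sub>v (?E *\<^sub>v y)"
    unfolding x_def using E v y by (intro mult_minus_distrib_mat_vec) auto
  also have "adj ?E *\<^sub>v (?E *\<^sub>v y) = y"
    using E y adj_mat_of_family_self[OF e] by (simp add: assoc_mult_mat_vec[symmetric, of _ k m _ k])
  also have "adj ?E *\<^sub>v v - y = 0\<^sub>v k" using y by (auto simp: y_def)
  finally have Ex: "adj ?E *\<^sub>v x = 0\<^sub>v k" .
  have we: "ip w (e i) = 0" if i: "i < k" for i
  proof -
    have "ip x (e i) = (adj ?E *\<^sub>v x) $ i" using mat_of_family_mult_vec_ip[of k e m x i] ec x i by simp
    also have "\<dots> = 0" using Ex i by simp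
    finally show ?thesis using x ec[OF i] by (simp add: w_def ip_smult_left[of _ m])
  qed
  then have ew: "ip (e i) w = 0" if i: "i < k" for i
    using ip_cnj[OF w ec[OF i]] i by simp
  have ww: "ip w w = 1"
    using vnorm_normalize[OF x x0] by (simp add: ip_self w_def)
  show ?thesis
  proof (rule that[of w])
    show "orthonormal_family m (Suc k) (e(k := w))"
      using e w we ew ww by (auto simp: orthonormal_family_def less_Suc_eq)
    fix A r assume A: "A \<in> carrier_mat r m" "A *\<^sub>v v = 0\<^sub>v r" "\<And>i. i < k \<Longrightarrow> A *\<^sub>v e i = 0\<^sub>v r"
    have "A *\<^sub>v (?E *\<^sub>v y) = (A * ?E) *\<^sub>v y" using A E y by (simp add: assoc_mult_mat_vec[of _ r m _ k])
    also have "\<dots> = 0\<^sub>v r" using mult_mat_of_family_zero[OF ec A(1,3)] y by auto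
    finally have "A *\<^sub>v x = 0\<^sub>v r"
      unfolding x_def using A v y by (subst mult_minus_distrib_mat_vec) auto
    then show "A *\<^sub>v w = 0\<^sub>v r" unfolding w_def mult_mat_vec[OF A(1) x] by (intro eq_vecI) auto
  qed
qed

text \<open>Induction on the number of missing vectors. As long as some are missing, a vector
  outside the span exists and \<open>orthonormal_extend\<close> applies.\<close>

lemma orthonormal_complete:
  assumes "orthonormal_family m k e"
  shows "\<exists>e'. orthonormal_family m m e' \<and> (\<forall>i<k. e' i = e i)"
  using assms
proof (induction "m - k" arbitrary: k e)
  case 0
  then have "k = m" using orthonormal_card_le[OF 0(2)] by simp
  then show ?case using 0 by blast
next
  case (Suc d)
  let ?E = "mat_of_family m k e"
  have E: "?E \<in> carrier_mat m k" "adj ?E \<in> carrier_mat k m" by auto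
  have "\<exists>v\<in>carrier_vec m. v \<noteq> ?E *\<^sub>v (adj ?E *\<^sub>v v)"
  proof (rule ccontr)
    assume "\<not> ?thesis"
    then have all: "?E *\<^sub>v (adj ?E *\<^sub>v v) = v" if "v \<in> carrier_vec m" for v using that by metis
    \<comment> \<open>If the projection onto the span were the identity, \<open>adj ?E\<close> would
      be isometric and map the standard basis to \<open>m\<close> orthonormal vectors in dimension
      \<open>k < m\<close>.\<close>
    define f where "f i = adj ?E *\<^sub>v unit_vec m i" for i
    have fc: "f i \<in> carrier_vec k" for i using E by (auto simp: f_def intro!: mult_mat_vec_carrier)
    have "ip (f i) (f j) = (if i = j then 1 else 0)" if "i < m" "j < m" for i j
    proof -
      have "ip (f i) (f j) = ip (unit_vec m i) (?E *\<^sub>v f j)"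
        unfolding f_def using E by (subst ip_adj[of _ k m]) (auto intro!: mult_mat_vec_carrier)
      also have "\<dots> = ip (unit_vec m i) (unit_vec m j)" unfolding f_def using all by auto
      also have "\<dots> = (if i = j then 1 else 0)"
        using that by (auto simp: ip_def unit_vec_def if_distrib[of cnj] if_distrib[of "\<lambda>x. x * _"] cong: if_cong)
      finally show ?thesis .
    qed
    then have "orthonormal_family k m f" using fc by (auto simp: orthonormal_family_def)
    then show False using orthonormal_card_le Suc(2) by fastforce
  qed
  then obtain v where v: "v \<in> carrier_vec m" "v \<noteq> ?E *\<^sub>v (adj ?E *\<^sub>v v)" by blast
  obtain w where w: "orthonormal_family m (Suc k) (e(k := w))" using orthonormal_extend[OF Suc(3) v] by metis
  have "d = m - Suc k" using Suc(2) by simp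
  from Suc(1)[OF this w] show ?case by (metis fun_upd_other less_Suc_eq nat_neq_iff)
qed

section \<open>Extremal vectors of quadratic forms\<close>

text \<open>A continuous function attains its maximum on the compact unit sphere. Vectors are
  encoded as functions on the naturals, so that compactness comes from the product topology; the
  bound for arbitrary \<open>v\<close> follows by scaling.\<close>

lemma quadratic_form_attains_max:
  assumes A: "A \<in> carrier_mat m m" and m: "0 < m"
  shows "\<exists>u\<in>carrier_vec m. vnorm u = 1 \<and>
    (\<forall>v\<in>carrier_vec m. Re (ip (A *\<^sub>v v) v) \<le> Re (ip (A *\<^sub>v u) u) * (vnorm v)\<^sup>2)"
proof -
  define R :: "complex set" where "R = {z. \<bar>Re z\<bar> \<le> 1 \<and> \<bar>Im z\<bar> \<le> 1}"
  have "R = (\<lambda>p. Complex (fst p) (snd p)) ` ({-1..1} \<times> {-1..1})"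
    by (force simp: R_def image_iff abs_le_iff intro!: bexI[of _ "(Re z, Im z)" for z])
  moreover have "compact \<dots>"
    unfolding complex_eq by (intro compact_continuous_image compact_Times compact_Icc continuous_intros)
  ultimately have "compact R" by simp
  \<comment> \<open>Coordinates from \<open>m\<close> on are pinned to 0, which makes
    \<open>K\<close> a product of compact sets over all indices; the square \<open>R\<close>
    contains the closed unit disc.\<close>
  define K where "K = (\<Pi>\<^sub>E i\<in>(UNIV::nat set). if i < m then R else {0})"
  define S where "S = K \<inter> {f. (\<Sum>i<m. (cmod (f i))\<^sup>2) = 1}"
  define Q where "Q f = Re (\<Sum>i<m. (\<Sum>j<m. A $$ (i,j) * f j) * cnj (f i))" for f :: "nat \<Rightarrow> complex"
  have "compactin (product_topology (\<lambda>i. euclidean) UNIV) K"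
    unfolding K_def compactin_PiE using \<open>compact R\<close> by (auto simp: compactin_euclidean_iff)
  then have "compact K" by (simp add: euclidean_product_topology compactin_euclidean_iff)
  moreover have "closed {f :: nat \<Rightarrow> complex. (\<Sum>i<m. (cmod (f i))\<^sup>2) = 1}"
    by (intro closed_Collect_eq continuous_intros continuous_on_product_coordinates)
  ultimately have S: "compact S" unfolding S_def by (rule compact_Int_closed)
  have "(\<lambda>i. if i = 0 then 1 else 0) \<in> S"
    using m by (auto simp: S_def K_def R_def if_distrib[of cmod] if_distrib[of "\<lambda>x. x\<^sup>2"] cong: if_cong)
  then have ne: "S \<noteq> {}" by auto
  have "continuous_on S Q"
    unfolding Q_def by (intro continuous_intros continuous_on_product_coordinates continuous_on_subset[OF continuous_on_product_coordinates]) auto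
  from continuous_attains_sup[OF S ne this] obtain f where f: "f \<in> S" and fmax: "\<forall>g\<in>S. Q g \<le> Q f" by blast
  have Q: "Re (ip (A *\<^sub>v vec m g) (vec m g)) = Q g" for g
    using A by (auto simp: ip_def Q_def mult_mat_vec_index[of A m m] simp del: index_mult_mat_vec intro!: sum.cong)
  have unit: "Re (ip (A *\<^sub>v v) v) \<le> Q f" if v: "v \<in> carrier_vec m" "vnorm v = 1" for v
  proof -
    define g where "g i = (if i < m then v $ i else 0)" for i
    have vg: "v = vec m g" using v by (auto simp: g_def)
    have sum1: "(\<Sum>i<m. (cmod (g i))\<^sup>2) = 1"
      using v by (auto simp: vnorm_def g_def)
    have "(cmod (g i))\<^sup>2 \<le> 1" if "i < m" for i
      using member_le_sum[of i "{..<m}" "\<lambda>i. (cmod (g i))\<^sup>2"] that sum1 by simp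
    then have "cmod (g i) \<le> 1" if "i < m" for i
      using that by (simp add: abs_square_le_1)
    then have "g i \<in> R" if "i < m" for i
      using that order_trans[OF abs_Re_le_cmod] order_trans[OF abs_Im_le_cmod] by (simp add: R_def)
    then have "g \<in> S" using sum1 by (auto simp: S_def K_def g_def)
    then show ?thesis using fmax Q vg by metis
  qed
  let ?u = "vec m f"
  have fS: "(\<Sum>i<m. (cmod (f i))\<^sup>2) = 1" using f by (auto simp: S_def)
  show ?thesis
  proof (intro bexI[of _ ?u] conjI ballI)
    show "vnorm ?u = 1" using fS by (simp add: vnorm_def)
    fix v :: "complex vec" assume v: "v \<in> carrier_vec m"
    show "Re (ip (A *\<^sub>v v) v) \<le> Re (ip (A *\<^sub>v ?u) ?u) * (vnorm v)\<^sup>2"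
    proof (cases "v = 0\<^sub>v m")
      case True
      then show ?thesis using A by simp
    next
      case False
      let ?c = "complex_of_real (1 / vnorm v)"
      have n0: "vnorm v > 0" using vnorm_eq_0_iff[OF v] False vnorm_nonneg[of v] by linarith
      have "Re (ip (A *\<^sub>v (?c \<cdot>\<^sub>v v)) (?c \<cdot>\<^sub>v v)) \<le> Q f"
        using v vnorm_normalize[OF v False] by (intro unit) auto
      also have "ip (A *\<^sub>v (?c \<cdot>\<^sub>v v)) (?c \<cdot>\<^sub>v v) = ?c * ?c * ip (A *\<^sub>v v) v"
        using A v by (simp add: mult_mat_vec[OF A v] ip_smult_left[of _ m] ip_smult_right[of _ m] mult_mat_vec_carrier[OF A] del: of_real_divide)
      also have "?c * ?c = complex_of_real (1 / (vnorm v)\<^sup>2)" by (simp add: power2_eq_square)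
      finally have "Re (ip (A *\<^sub>v v) v) / (vnorm v)\<^sup>2 \<le> Q f" by (simp del: of_real_divide)
      then show ?thesis using n0 by (simp add: Q field_simps)
    qed
  qed simp
qed

section \<open>Nonnegative forms and first-order arguments\<close>

lemma le_linear_imp_nonpos:
  fixes a c :: real
  assumes "\<And>t. 0 < t \<Longrightarrow> a \<le> t * c"
  shows "a \<le> 0"
proof (rule ccontr)
  assume a: "\<not> a \<le> 0"
  \<comment> \<open>The value of \<open>t\<close> is chosen so that \<open>t * c\<close> is at most
    half of \<open>a\<close>.\<close>
  have "a \<le> (a / (2 * (\<bar>c\<bar> + 1))) * c" using a by (intro assms) auto
  also have "\<dots> \<le> (a / (2 * (\<bar>c\<bar> + 1))) * (\<bar>c\<bar> + 1)" using a by (intro mult_left_mono) auto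
  also have "\<dots> = a / 2" by (simp add: field_simps)
  finally show False using a by simp
qed

text \<open>Moving from \<open>u\<close> by \<open>-t\<close> times \<open>P *\<^sub>v u\<close>
  changes the form by \<open>-2 t\<close> times the squared norm of \<open>P *\<^sub>v u\<close>, up
  to order \<open>t\<close> squared. Nonnegativity for small \<open>t\<close> forces that norm to be
  0.\<close>

lemma psd_form_zero_imp_kernel:
  assumes P: "P \<in> carrier_mat m m" and herm: "adj P = P"
    and psd: "\<And>v. v \<in> carrier_vec m \<Longrightarrow> 0 \<le> Re (ip (P *\<^sub>v v) v)"
    and u: "u \<in> carrier_vec m" and zero: "Re (ip (P *\<^sub>v u) u) = 0"
  shows "P *\<^sub>v u = 0\<^sub>v m"
proof -
  define w where "w = P *\<^sub>v u"
  have w: "w \<in> carrier_vec m" using P u by (auto simp: w_def)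
  have Pw: "P *\<^sub>v w \<in> carrier_vec m" using P w by (auto intro!: mult_mat_vec_carrier)
  have "2 * (vnorm w)\<^sup>2 \<le> t * Re (ip (P *\<^sub>v w) w)" if t: "0 < t" for t
  proof -
    let ?s = "complex_of_real (- t)"
    have e1: "P *\<^sub>v (u + ?s \<cdot>\<^sub>v w) = w + ?s \<cdot>\<^sub>v (P *\<^sub>v w)"
      using P u w by (simp add: mult_add_distrib_mat_vec[of _ m m] mult_mat_vec[of _ m m] w_def)
    have e2: "ip (P *\<^sub>v w) u = ip w w"
      using ip_adj[OF P w u] herm by (simp add: w_def)
    have "ip (w + ?s \<cdot>\<^sub>v (P *\<^sub>v w)) (u + ?s \<cdot>\<^sub>v w) = ip w u + ?s * ip w w + ?s * (ip (P *\<^sub>v w) u + ?s * ip (P *\<^sub>v w) w)"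
      using u w Pw by (simp add: ip_add_left[of _ m] ip_add_right[of _ m] ip_smult_left[of _ m] ip_smult_right[of _ m] algebra_simps)
    then have "0 \<le> Re (ip w u + ?s * ip w w + ?s * (ip (P *\<^sub>v w) u + ?s * ip (P *\<^sub>v w) w))"
      using psd[of "u + ?s \<cdot>\<^sub>v w"] e1 u w by simp
    then have "0 \<le> - 2 * t * (vnorm w)\<^sup>2 + t * t * Re (ip (P *\<^sub>v w) w)"
      using zero unfolding e2 w_def[symmetric] by (simp add: ip_self algebra_simps)
    then have "t * (2 * (vnorm w)\<^sup>2) \<le> t * (t * Re (ip (P *\<^sub>v w) w))" by (simp add: algebra_simps)
    then show ?thesis using t by simp
  qed
  then have "2 * (vnorm w)\<^sup>2 \<le> 0" by (rule le_linear_imp_nonpos)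
  then have "vnorm w = 0" by simp
  then show ?thesis using vnorm_eq_0_iff[OF w] by (simp add: w_def)
qed

text \<open>The form of \<open>1\<^sub>m m - adj A * A\<close> at \<open>v\<close> is the squared
  norm of \<open>v\<close> minus that of \<open>A *\<^sub>v v\<close>. It is nonnegative and
  vanishes at \<open>u\<close>, so \<open>psd_form_zero_imp_kernel\<close> applies.\<close>

lemma contraction_isometric_vector:
  assumes A: "A \<in> carrier_mat m m"
    and contr: "\<And>v. v \<in> carrier_vec m \<Longrightarrow> vnorm (A *\<^sub>v v) \<le> vnorm v"
    and u: "u \<in> carrier_vec m" and eq: "vnorm (A *\<^sub>v u) = vnorm u"
  shows "adj A *\<^sub>v (A *\<^sub>v u) = u"
proof -
  let ?P = "1\<^sub>m m - adj A * A"
  have AA: "adj A * A \<in> carrier_mat m m" using A by auto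
  have P: "?P \<in> carrier_mat m m" using A by auto
  have Pv: "?P *\<^sub>v v = v - adj A *\<^sub>v (A *\<^sub>v v)" if "v \<in> carrier_vec m" for v
    using that A AA by (simp add: minus_mult_distrib_mat_vec[of _ m m] assoc_mult_mat_vec[of _ m m _ m])
  have form: "Re (ip (?P *\<^sub>v v) v) = (vnorm v)\<^sup>2 - (vnorm (A *\<^sub>v v))\<^sup>2" if v: "v \<in> carrier_vec m" for v
  proof -
    have Av: "A *\<^sub>v v \<in> carrier_vec m" "adj A *\<^sub>v (A *\<^sub>v v) \<in> carrier_vec m" using A v by (auto intro!: mult_mat_vec_carrier)
    have "v - adj A *\<^sub>v (A *\<^sub>v v) = v + (-1) \<cdot>\<^sub>v (adj A *\<^sub>v (A *\<^sub>v v))"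
      using v Av by (intro eq_vecI) auto
    then show ?thesis
      using v Av ip_adj[of "adj A" m m "A *\<^sub>v v" v] A by (simp add: Pv ip_add_left[of _ m] ip_smult_left[of _ m] vnorm_square)
  qed
  have "?P *\<^sub>v u = 0\<^sub>v m"
  proof (rule psd_form_zero_imp_kernel[OF P])
    show "adj ?P = ?P"
    proof (rule eq_matI)
      fix i j assume "i < dim_row ?P" "j < dim_col ?P"
      then have ij: "i < m" "j < m" using A by auto
      have "adj (adj A * A) = adj A * A" using A adj_mult[of "adj A" m m A m] by auto
      then have "cnj ((adj A * A) $$ (j,i)) = (adj A * A) $$ (i,j)"
        using adj_index[of i "adj A * A" j] ij A AA by auto
      then show "adj ?P $$ (i,j) = ?P $$ (i,j)" using ij P AA A by simp
    qed (use A in auto)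
    show "0 \<le> Re (ip (?P *\<^sub>v v) v)" if "v \<in> carrier_vec m" for v
      using form[OF that] contr[OF that] by (simp add: power_mono)
  qed (use u form eq in auto)
  then have "u - adj A *\<^sub>v (A *\<^sub>v u) = 0\<^sub>v m" using Pv u by simp
  then have "u $ i - (adj A *\<^sub>v (A *\<^sub>v u)) $ i = 0" if "i < m" for i
    using that u A by (metis carrier_vecD index_minus_vec(1) index_zero_vec(1) dim_mult_mat_vec dim_adj(1) carrier_matD(2))
  then show ?thesis using u A by (intro eq_vecI) auto
qed

section \<open>Toeplitz matrices and positivity\<close>

lemma smult_mat_mult_mat_vec:
  assumes "A \<in> carrier_mat r m" "v \<in> carrier_vec m"
  shows "(c \<cdot>\<^sub>m A) *\<^sub>v v = c \<cdot>\<^sub>v (A *\<^sub>v v)"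
  using assms by (intro eq_vecI) (auto simp: scalar_prod_def sum_distrib_left mult_ac intro!: sum.cong)

text \<open>Superdiagonal \<open>k\<close> carries \<open>a k\<close>, so only the values below
  \<open>n\<close> matter. Arbitrary coefficient functions make linear combinations pointwise and
  avoid polynomials.\<close>

definition toep :: "nat \<Rightarrow> (nat \<Rightarrow> complex) \<Rightarrow> complex mat" where
  "toep n a = mat n n (\<lambda>(i,j). if i \<le> j then a (j - i) else 0)"

lemma toep_carrier[simp, intro]: "toep n a \<in> carrier_mat n n"
  by (simp add: toep_def)

lemma toep_add: "toep n a + toep n b = toep n (\<lambda>k. a k + b k)"
  by (rule eq_matI) (auto simp: toep_def)

lemma toep_smult: "c \<cdot>\<^sub>m toep n a = toep n (\<lambda>k. c * a k)"
  by (rule eq_matI) (auto simp: toep_def)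

lemma toep_one: "toep n (\<lambda>k. if k = 0 then 1 else 0) = 1\<^sub>m n"
  by (rule eq_matI) (auto simp: toep_def)

lemma toep_cong: "(\<And>k. k < n \<Longrightarrow> a k = b k) \<Longrightarrow> toep n a = toep n b"
  by (rule eq_matI) (auto simp: toep_def)

lemma jordan_shift_pow: "jordan_shift n ^\<^sub>m k = mat n n (\<lambda>(i,j). if j = i + k then 1 else 0)"
proof (induction k)
  case 0
  show ?case by (rule eq_matI) (auto simp: jordan_shift_def)
next
  case (Suc k)
  show ?case
  proof (rule eq_matI)
    fix i j assume "i < dim_row (mat n n (\<lambda>(i, j). if j = i + Suc k then 1 else (0::complex)))"
      "j < dim_col (mat n n (\<lambda>(i, j). if j = i + Suc k then 1 else (0::complex)))"
    then have ij: "i < n" "j < n" by auto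
    have "(jordan_shift n ^\<^sub>m Suc k) $$ (i,j) = (\<Sum>l<n. (if l = i + k then 1 else 0) * jordan_shift n $$ (l,j))"
      using ij unfolding pow_mat.simps Suc
      by (subst mult_mat_index[of _ n n _ n]) (auto simp: jordan_shift_def)
    also have "\<dots> = (\<Sum>l<n. if l = i + k then (if j = Suc (i + k) then 1 else 0) else 0)"
      using ij by (intro sum.cong) (auto simp: jordan_shift_def)
    also have "\<dots> = (if j = i + Suc k then 1 else 0)" using ij by auto
    finally show "(jordan_shift n ^\<^sub>m Suc k) $$ (i,j) = mat n n (\<lambda>(i, j). if j = i + Suc k then 1 else 0) $$ (i,j)"
      using ij by simp
  qed (auto simp: Suc jordan_shift_def)
qed

lemma poly_eval_jordan_shift: "poly_eval_mat f (jordan_shift n) = toep n (coeff f)"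
proof (rule eq_matI)
  fix i j assume "i < dim_row (toep n (coeff f))" "j < dim_col (toep n (coeff f))"
  then have ij: "i < n" "j < n" by (auto simp: toep_def)
  have "poly_eval_mat f (jordan_shift n) $$ (i,j) = (\<Sum>k\<le>degree f. if i \<le> j \<and> k = j - i then coeff f k else 0)"
    using ij unfolding poly_eval_mat_def jordan_shift_pow by (auto simp: jordan_shift_def intro!: sum.cong)
  also have "\<dots> = toep n (coeff f) $$ (i,j)"
    using ij coeff_eq_0[of f "j - i"] by (auto simp: toep_def)
  finally show "poly_eval_mat f (jordan_shift n) $$ (i,j) = toep n (coeff f) $$ (i,j)" .
qed (auto simp: poly_eval_mat_def toep_def jordan_shift_def)

text \<open>Every coefficient function agrees below \<open>n\<close> with the coefficients of a
  polynomial, namely its truncation.\<close>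

lemma toeplitz_alg_eq: "toeplitz_alg n = range (toep n)"
proof -
  have "toep n a \<in> toeplitz_alg n" for a
  proof -
    have "toep n a = toep n (coeff (Poly (map a [0..<n])))"
      by (rule toep_cong) (simp add: nth_default_def)
    then show ?thesis unfolding toeplitz_alg_def poly_eval_jordan_shift[symmetric] by blast
  qed
  then show ?thesis by (auto simp: toeplitz_alg_def poly_eval_jordan_shift)
qed

text \<open>For \<open>t > 0\<close>, positivity of \<open>X\<close> bounds the squared norm of
  \<open>1 - t X\<close> by \<open>1 + O(t^2)\<close>. The same bound for \<open>1 - t Y\<close>,
  expanded at \<open>v\<close>, leaves a first-order term that must have the right sign. An isometry
  supplies the norm comparison in both directions.\<close>

lemma form_nonneg_transfer:
  assumes X: "X \<in> carrier_mat d d" and Y: "Y \<in> carrier_mat k k"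
    and le: "\<And>t::real. opnorm (1\<^sub>m k + complex_of_real t \<cdot>\<^sub>m Y) \<le> opnorm (1\<^sub>m d + complex_of_real t \<cdot>\<^sub>m X)"
    and pos: "\<And>v. v \<in> carrier_vec d \<Longrightarrow> 0 \<le> Re (ip (X *\<^sub>v v) v)"
    and v: "v \<in> carrier_vec k"
  shows "0 \<le> Re (ip (Y *\<^sub>v v) v)"
proof -
  have norm: "(vnorm ((1\<^sub>m p + complex_of_real (- t) \<cdot>\<^sub>m Z) *\<^sub>v w))\<^sup>2 =
      (vnorm w)\<^sup>2 - 2 * t * Re (ip (Z *\<^sub>v w) w) + t\<^sup>2 * (vnorm (Z *\<^sub>v w))\<^sup>2"
    if Z: "Z \<in> carrier_mat p p" and w: "w \<in> carrier_vec p" for Z p w t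
  proof -
    have Zw: "Z *\<^sub>v w \<in> carrier_vec p" using Z w by auto
    have "(1\<^sub>m p + complex_of_real (- t) \<cdot>\<^sub>m Z) *\<^sub>v w = w + complex_of_real (- t) \<cdot>\<^sub>v (Z *\<^sub>v w)"
      using Z w by (subst add_mult_distrib_mat_vec[of _ p p]) (auto simp: smult_mat_mult_mat_vec)
    moreover have "Re (ip w (Z *\<^sub>v w)) = Re (ip (Z *\<^sub>v w) w)"
      using ip_cnj[OF w Zw] by (metis cnj.sel(1))
    ultimately show ?thesis using w Zw
      by (simp add: vnorm_pythagoras[of _ p] ip_smult_right[of _ p] vnorm_smult power_mult_distrib)
  qed
  have "- 2 * Re (ip (Y *\<^sub>v v) v) \<le> t * ((opnorm X)\<^sup>2 * (vnorm v)\<^sup>2)" if t: "0 < t" for t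
  proof -
    let ?c = "sqrt (1 + t\<^sup>2 * (opnorm X)\<^sup>2)"
    have X1: "1\<^sub>m d + complex_of_real (- t) \<cdot>\<^sub>m X \<in> carrier_mat d d" using X by auto
    have Y1: "1\<^sub>m k + complex_of_real (- t) \<cdot>\<^sub>m Y \<in> carrier_mat k k" using Y by auto
    have "opnorm (1\<^sub>m d + complex_of_real (- t) \<cdot>\<^sub>m X) \<le> ?c"
    proof (rule opnorm_le[OF X1])
      fix w :: "complex vec" assume w: "w \<in> carrier_vec d"
      have "(vnorm ((1\<^sub>m d + complex_of_real (- t) \<cdot>\<^sub>m X) *\<^sub>v w))\<^sup>2 \<le> (vnorm w)\<^sup>2 + t\<^sup>2 * (vnorm (X *\<^sub>v w))\<^sup>2"
        unfolding norm[OF X w] using pos[OF w] t by simp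
      also have "\<dots> \<le> (vnorm w)\<^sup>2 + t\<^sup>2 * (opnorm X * vnorm w)\<^sup>2"
        using vnorm_mult_le_opnorm[OF X w] by (intro add_left_mono mult_left_mono power_mono) auto
      also have "\<dots> = (?c * vnorm w)\<^sup>2" by (simp add: power_mult_distrib algebra_simps)
      finally show "vnorm ((1\<^sub>m d + complex_of_real (- t) \<cdot>\<^sub>m X) *\<^sub>v w) \<le> ?c * vnorm w"
        by (rule power2_le_imp_le) simp
    qed simp
    then have "opnorm (1\<^sub>m k + complex_of_real (- t) \<cdot>\<^sub>m Y) \<le> ?c" using le[of "- t"] by linarith
    then have "vnorm ((1\<^sub>m k + complex_of_real (- t) \<cdot>\<^sub>m Y) *\<^sub>v v) \<le> ?c * vnorm v"
      using vnorm_mult_le_opnorm[OF Y1 v] by (meson mult_right_mono order_trans vnorm_nonneg)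
    then have "(vnorm ((1\<^sub>m k + complex_of_real (- t) \<cdot>\<^sub>m Y) *\<^sub>v v))\<^sup>2 \<le> (?c * vnorm v)\<^sup>2"
      by (intro power_mono) auto
    moreover have "(?c * vnorm v)\<^sup>2 = (vnorm v)\<^sup>2 + t\<^sup>2 * ((opnorm X)\<^sup>2 * (vnorm v)\<^sup>2)"
      by (simp add: power_mult_distrib algebra_simps)
    moreover have "0 \<le> t\<^sup>2 * (vnorm (Y *\<^sub>v v))\<^sup>2" by simp
    ultimately have "- 2 * t * Re (ip (Y *\<^sub>v v) v) \<le> t\<^sup>2 * ((opnorm X)\<^sup>2 * (vnorm v)\<^sup>2)"
      unfolding norm[OF Y v] by linarith
    then have "t * (- 2 * Re (ip (Y *\<^sub>v v) v)) \<le> t * (t * ((opnorm X)\<^sup>2 * (vnorm v)\<^sup>2))"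
      by (simp add: power2_eq_square mult_ac)
    then show ?thesis using t by (simp only: mult_le_cancel_left_pos)
  qed
  then have "- 2 * Re (ip (Y *\<^sub>v v) v) \<le> 0" by (rule le_linear_imp_nonpos)
  then show ?thesis by simp
qed

section \<open>Hermitian parts and the rank one projections\<close>

definition herm :: "complex mat \<Rightarrow> complex mat" where
  "herm A = (1/2) \<cdot>\<^sub>m (A + adj A)"

lemma herm_carrier[simp, intro]: "A \<in> carrier_mat m m \<Longrightarrow> herm A \<in> carrier_mat m m"
  by (auto simp: herm_def)

lemma adj_herm: "A \<in> carrier_mat m m \<Longrightarrow> adj (herm A) = herm A"
  by (rule eq_matI) (auto simp: herm_def)

lemma ip_herm:
  assumes A: "A \<in> carrier_mat m m" and v: "v \<in> carrier_vec m"
  shows "ip (herm A *\<^sub>v v) v = complex_of_real (Re (ip (A *\<^sub>v v) v))"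
proof -
  have Av: "A *\<^sub>v v \<in> carrier_vec m" "adj A *\<^sub>v v \<in> carrier_vec m" using A v by (auto intro!: mult_mat_vec_carrier)
  have "herm A *\<^sub>v v = (1/2) \<cdot>\<^sub>v (A *\<^sub>v v + adj A *\<^sub>v v)"
    unfolding herm_def using A v by (simp add: add_mult_distrib_mat_vec[of _ m m] smult_mat_mult_mat_vec[of _ m m])
  moreover have "ip (adj A *\<^sub>v v) v = cnj (ip (A *\<^sub>v v) v)"
    using ip_adj[of "adj A" m m v v] ip_cnj[OF Av(1) v] A v by simp
  ultimately have "ip (herm A *\<^sub>v v) v = (ip (A *\<^sub>v v) v + cnj (ip (A *\<^sub>v v) v)) / 2"
    using Av v by (simp add: ip_smult_left[of _ m] ip_add_left[of _ m])
  then show ?thesis by (simp add: complex_add_cnj)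
qed

text \<open>For \<open>\<bar>z\<bar> = 1\<close> these are the coefficients of the upper triangular Toeplitz matrix whose Hermitian part is
  the orthogonal projection onto the span of \<open>(1, z, \<dots>, z\<^sup>n\<^sup>-\<^sup>1)\<close>.\<close>
definition proj_coeff :: "nat \<Rightarrow> complex \<Rightarrow> nat \<Rightarrow> complex" where
  "proj_coeff n z l = (if l = 0 then 1 else 2 * cnj z ^ l) / of_nat n"

text \<open>The factor 2 off the diagonal in \<open>proj_coeff\<close> compensates the one half in
  \<open>herm\<close>, and unimodularity of \<open>z\<close> turns \<open>z ^ i * cnj z ^ j\<close>
  into a power of \<open>z\<close> or \<open>cnj z\<close> with exponent the difference of
  \<open>i\<close> and \<open>j\<close>.\<close>

lemma herm_toep_proj_coeff:
  assumes z: "cmod z = 1"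
  shows "herm (toep n (proj_coeff n z)) = mat n n (\<lambda>(i,j). z ^ i * cnj z ^ j / of_nat n)"
proof (rule eq_matI)
  fix i j assume "i < dim_row (mat n n (\<lambda>(i,j). z ^ i * cnj z ^ j / of_nat n))"
     "j < dim_col (mat n n (\<lambda>(i,j). z ^ i * cnj z ^ j / of_nat n))"
  then have ij: "i < n" "j < n" by auto
  have zz: "z * cnj z = 1" using z by (simp add: complex_norm_square[symmetric])
  have zk: "z ^ k * cnj z ^ k = 1" for k using zz by (simp add: power_mult_distrib[symmetric])
  have zij: "z ^ i * cnj z ^ j = cnj z ^ (j - i)" if "i \<le> j"
    using that zk[of i] power_add[of "cnj z" i "j - i"] by simp
  have zji: "z ^ i * cnj z ^ j = z ^ (i - j)" if "j \<le> i"
    using that zk[of j] power_add[of z j "i - j"] by (simp add: mult_ac)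
  have "herm (toep n (proj_coeff n z)) $$ (i,j) =
      ((if i \<le> j then proj_coeff n z (j - i) else 0) + cnj (if j \<le> i then proj_coeff n z (i - j) else 0)) / 2"
    using ij by (simp add: herm_def toep_def)
  also have "\<dots> = z ^ i * cnj z ^ j / of_nat n"
    using zij zji by (cases i j rule: linorder_cases) (auto simp: proj_coeff_def)
  finally show "herm (toep n (proj_coeff n z)) $$ (i,j) = mat n n (\<lambda>(i,j). z ^ i * cnj z ^ j / of_nat n) $$ (i,j)"
    using ij by simp
qed (auto simp: herm_def toep_def)

text \<open>The Hermitian part has rank one, so the form is a squared modulus. Positivity and the
  upper bound by the squared norm can be read off from it.\<close>

lemma form_toep_proj_coeff:
  assumes z: "cmod z = 1" and v: "v \<in> carrier_vec n"
  shows "Re (ip (toep n (proj_coeff n z) *\<^sub>v v) v) = (cmod (\<Sum>j<n. cnj z ^ j * v $ j))\<^sup>2 / of_nat n"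
proof -
  let ?w = "\<Sum>j<n. cnj z ^ j * v $ j"
  have "ip (herm (toep n (proj_coeff n z)) *\<^sub>v v) v = (\<Sum>i<n. (\<Sum>j<n. z ^ i * cnj z ^ j / of_nat n * v $ j) * cnj (v $ i))"
    unfolding herm_toep_proj_coeff[OF z] using v
    by (auto simp: ip_def mult_mat_vec_index[of _ n n] simp del: index_mult_mat_vec intro!: sum.cong)
  also have "\<dots> = (\<Sum>i<n. ?w * cnj (cnj z ^ i * v $ i) / of_nat n)"
    by (intro sum.cong) (auto simp: sum_distrib_left sum_distrib_right sum_divide_distrib mult_ac)
  also have "\<dots> = ?w * cnj ?w / of_nat n"
    by (simp add: sum_distrib_left sum_divide_distrib)
  also have "\<dots> = complex_of_real ((cmod ?w)\<^sup>2 / of_nat n)"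
    by (simp only: complex_norm_square of_real_divide of_real_of_nat_eq)
  finally show ?thesis using ip_herm[OF toep_carrier v, of "proj_coeff n z"] by (metis of_real_eq_iff)
qed

text \<open>The sum is geometric with ratio \<open>q\<close>, an \<open>n\<close>-th root of unity
  that equals 1 exactly when \<open>n\<close> divides \<open>e\<close>.\<close>

lemma sum_powers_of_roots:
  assumes n: "0 < n"
  shows "(\<Sum>j<n. (\<zeta> * cis (2 * pi * real j / real n)) ^ e) = (if n dvd e then of_nat n * \<zeta> ^ e else 0)"
proof -
  define q where "q = cis (2 * pi * real e / real n)"
  have "(\<zeta> * cis (2 * pi * real j / real n)) ^ e = \<zeta> ^ e * q ^ j" for j
    by (simp add: power_mult_distrib DeMoivre q_def mult_ac)
  then have eq: "(\<Sum>j<n. (\<zeta> * cis (2 * pi * real j / real n)) ^ e) = \<zeta> ^ e * (\<Sum>j<n. q ^ j)"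
    by (simp add: sum_distrib_left)
  have q1: "q = 1 \<longleftrightarrow> n dvd e"
  proof
    assume "q = 1"
    then have "cos (2 * pi * real e / real n) = 1" by (metis q_def cis.sel(1) one_complex.sel(1))
    then obtain k :: int where k: "2 * pi * real e / real n = of_int k * 2 * pi"
      unfolding cos_one_2pi_int by blast
    then have "real e = of_int k * real n" using n by (simp add: field_simps)
    then have "real_of_int (int e) = of_int (k * int n)" by simp
    then have "int e = k * int n" by (simp only: of_int_eq_iff)
    then show "n dvd e" by (metis dvd_triv_right int_dvd_int_iff)
  next
    assume "n dvd e"
    then obtain k where "e = n * k" by auto
    then show "q = 1" using n cis_multiple_2pi[of "real k"] by (simp add: q_def mult.assoc)
  qed
  show ?thesis
  proof (cases "n dvd e")
    case True
    then show ?thesis using q1 eq by simp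
  next
    case False
    have "q ^ n = cis (2 * pi * real e)" using n by (simp add: q_def DeMoivre)
    then have "q ^ n = 1" using cis_multiple_2pi[of "real e"] by simp
    then show ?thesis using False q1 eq geometric_sum[of q n] by simp
  qed
qed

section \<open>Unital isometries of the Toeplitz algebra\<close>

text \<open>Interpreted twice below: for the given map, and for its composition with the embedding
  into the envelope, where both dimensions are \<open>n\<close>.\<close>

locale toeplitz_isometry =
  fixes n m :: nat and \<phi> :: "complex mat \<Rightarrow> complex mat"
  assumes n_pos: "0 < n"
    and lin: "unital_linear_on (toeplitz_alg n) n m \<phi>"
    and isom: "\<And>X. X \<in> toeplitz_alg n \<Longrightarrow> opnorm (\<phi> X) = opnorm X"
begin

text \<open>The image of the \<open>k\<close>-th power of the shift. For \<open>k \<ge> n\<close>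
  the argument is the zero matrix; the resulting \<open>T k = 0\<close> later gives
  nilpotency.\<close>

definition T :: "nat \<Rightarrow> complex mat" where
  "T k = \<phi> (toep n (\<lambda>i. if i = k then 1 else 0))"

lemma toep_in[simp, intro]: "toep n a \<in> toeplitz_alg n"
  by (auto simp: toeplitz_alg_eq)

lemma phi_carrier[simp, intro]: "\<phi> (toep n a) \<in> carrier_mat m m"
  using lin by (auto simp: unital_linear_on_def)

lemma phi_add: "\<phi> (toep n (\<lambda>k. a k + b k)) = \<phi> (toep n a) + \<phi> (toep n b)"
  using lin toep_in by (metis toep_add unital_linear_on_def)

lemma phi_smult: "\<phi> (toep n (\<lambda>k. c * a k)) = c \<cdot>\<^sub>m \<phi> (toep n a)"
  using lin toep_in by (metis toep_smult unital_linear_on_def)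

lemma T_carrier[simp, intro]: "T k \<in> carrier_mat m m"
  by (simp add: T_def)

lemma T_0: "T 0 = 1\<^sub>m m"
  using lin by (simp add: T_def toep_one unital_linear_on_def)

text \<open>Linearity of the map, obtained by truncating the coefficients and adding one
  superdiagonal at a time.\<close>

lemma phi_toep_index:
  assumes rs: "r < m" "s < m"
  shows "\<phi> (toep n a) $$ (r,s) = (\<Sum>k<n. a k * T k $$ (r,s))"
proof -
  have "\<phi> (toep n (\<lambda>k. if k < K then a k else 0)) $$ (r,s) = (\<Sum>k<K. a k * T k $$ (r,s))" for K
  proof (induction K)
    case 0
    have "\<phi> (toep n (\<lambda>k. 0 * a k)) = 0 \<cdot>\<^sub>m \<phi> (toep n a)" by (rule phi_smult)
    then show ?case using rs carrier_matD[OF phi_carrier[of a]] by simp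
  next
    case (Suc K)
    have "(\<lambda>k. if k < Suc K then a k else 0) = (\<lambda>k. (if k < K then a k else 0) + a K * (if k = K then 1 else 0))"
      by (auto simp: less_Suc_eq)
    then have "\<phi> (toep n (\<lambda>k. if k < Suc K then a k else 0)) =
        \<phi> (toep n (\<lambda>k. if k < K then a k else 0)) + a K \<cdot>\<^sub>m T K"
      by (simp only: phi_add phi_smult T_def)
    then show ?case using Suc rs carrier_matD[OF T_carrier[of K]] by simp
  qed
  from this[of n] show ?thesis
    using toep_cong[of n "\<lambda>k. if k < n then a k else 0" a] by simp
qed

lemma T_eq_0:
  assumes "n \<le> k"
  shows "T k = 0\<^sub>m m m"
proof (rule eq_matI)
  fix r s assume "r < dim_row (0\<^sub>m m m :: complex mat)" "s < dim_col (0\<^sub>m m m :: complex mat)"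
  then have rs: "r < m" "s < m" by auto
  have "T k $$ (r,s) = (\<Sum>i<n. (if i = k then 1 else 0) * T i $$ (r,s))"
    using phi_toep_index[OF rs, of "\<lambda>i. if i = k then 1 else 0"] by (simp only: T_def[of k])
  also have "\<dots> = 0" using assms by (intro sum.neutral) auto
  finally show "T k $$ (r,s) = 0\<^sub>m m m $$ (r,s)" using rs by simp
qed (use carrier_matD[OF T_carrier[of k]] in auto)

lemma opnorm_phi_line:
  "opnorm (1\<^sub>m m + t \<cdot>\<^sub>m \<phi> (toep n a)) = opnorm (1\<^sub>m n + t \<cdot>\<^sub>m toep n a)"
proof -
  have "1\<^sub>m n + t \<cdot>\<^sub>m toep n a = toep n (\<lambda>k. (if k = 0 then 1 else 0) + t * a k)"
    by (simp add: toep_smult toep_add flip: toep_one)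
  moreover have "1\<^sub>m m + t \<cdot>\<^sub>m \<phi> (toep n a) = \<phi> (toep n (\<lambda>k. (if k = 0 then 1 else 0) + t * a k))"
    unfolding phi_add phi_smult using T_0 by (simp add: T_def)
  ultimately show ?thesis using isom toep_in by metis
qed

section \<open>Positivity carried through the isometry in both directions\<close>

lemma phi_form_nonneg:
  assumes "\<And>v. v \<in> carrier_vec n \<Longrightarrow> 0 \<le> Re (ip (toep n a *\<^sub>v v) v)" "v \<in> carrier_vec m"
  shows "0 \<le> Re (ip (\<phi> (toep n a) *\<^sub>v v) v)"
  using form_nonneg_transfer[of "toep n a" n "\<phi> (toep n a)" m v] assms opnorm_phi_line by auto

lemma toep_form_nonneg:
  assumes "\<And>v. v \<in> carrier_vec m \<Longrightarrow> 0 \<le> Re (ip (\<phi> (toep n a) *\<^sub>v v) v)" "v \<in> carrier_vec n"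
  shows "0 \<le> Re (ip (toep n a *\<^sub>v v) v)"
  using form_nonneg_transfer[of "\<phi> (toep n a)" m "toep n a" n v] assms opnorm_phi_line by auto

text \<open>In dimension 0 the identity would have norm 0, whereas the identity of positive size
  \<open>n\<close> has norm at least 1. Positivity of \<open>m\<close> is what allows maximizing
  over the unit sphere.\<close>

lemma m_pos: "0 < m"
proof (rule ccontr)
  assume "\<not> 0 < m"
  then have m: "m = 0" by simp
  have "opnorm (1\<^sub>m m) \<le> 0" using m by (intro opnorm_le[of _ m m]) (auto simp: vnorm_def)
  moreover have "opnorm (1\<^sub>m m) = opnorm (1\<^sub>m n)"
    using isom[OF toep_in, of "\<lambda>k. if k = 0 then 1 else 0"] T_0 by (simp add: T_def toep_one)
  moreover have "vnorm (unit_vec n 0) = 1"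
    using n_pos by (simp add: vnorm_def unit_vec_def if_distrib[of cmod] if_distrib[of "\<lambda>x. x\<^sup>2"] cong: if_cong)
  ultimately show False
    using vnorm_mult_le_opnorm[of "1\<^sub>m n" n n "unit_vec n 0"] by simp
qed

definition H :: "complex \<Rightarrow> complex mat" where
  "H z = herm (\<phi> (toep n (proj_coeff n z)))"

lemma H_carrier[simp, intro]: "H z \<in> carrier_mat m m"
  by (simp add: H_def)

lemma adj_H: "adj (H z) = H z"
  unfolding H_def by (rule adj_herm[OF phi_carrier])

lemma H_nonneg:
  assumes z: "cmod z = 1" and v: "v \<in> carrier_vec m"
  shows "0 \<le> Re (ip (H z *\<^sub>v v) v)"
  using phi_form_nonneg[of "proj_coeff n z", OF _ v] form_toep_proj_coeff[OF z] v
  by (simp add: H_def ip_herm[of _ m])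

text \<open>The difference \<open>c I - X\<close> is written as a sum of scalar multiples, the shape
  to which \<open>phi_add\<close> and \<open>phi_smult\<close> apply.\<close>

lemma form_affine:
  assumes X: "X \<in> carrier_mat d d" and v: "v \<in> carrier_vec d"
  shows "Re (ip ((complex_of_real c \<cdot>\<^sub>m 1\<^sub>m d + (-1) \<cdot>\<^sub>m X) *\<^sub>v v) v) = c * (vnorm v)\<^sup>2 - Re (ip (X *\<^sub>v v) v)"
proof -
  have "(complex_of_real c \<cdot>\<^sub>m 1\<^sub>m d + (-1) \<cdot>\<^sub>m X) *\<^sub>v v = complex_of_real c \<cdot>\<^sub>v v + (-1) \<cdot>\<^sub>v (X *\<^sub>v v)"
    using X v by (simp add: add_mult_distrib_mat_vec[of _ d d] smult_mat_mult_mat_vec[of _ d d])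
  then show ?thesis using X v
    by (simp add: ip_add_left[of _ d] ip_smult_left[of _ d] ip_self mult_mat_vec_carrier[OF X])
qed

lemma toep_affine:
  "c \<cdot>\<^sub>m 1\<^sub>m n + (-1) \<cdot>\<^sub>m toep n a = toep n (\<lambda>k. c * (if k = 0 then 1 else 0) + (-1) * a k)"
  by (simp only: toep_smult toep_add flip: toep_one)

lemma phi_affine:
  "\<phi> (toep n (\<lambda>k. c * (if k = 0 then 1 else 0) + (-1) * a k)) = c \<cdot>\<^sub>m 1\<^sub>m m + (-1) \<cdot>\<^sub>m \<phi> (toep n a)"
  unfolding phi_add phi_smult T_0[symmetric] T_def ..

text \<open>Let \<open>c\<close> be the maximum of the form of the image on the unit sphere,
  attained at \<open>u\<close>. Positivity pulled back gives \<open>c \<ge> 1\<close>, positivity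
  pushed forward gives \<open>c \<le> 1\<close>; so the nonnegative form of \<open>1 - H z\<close>
  vanishes at \<open>u\<close>.\<close>

lemma H_fixed_vector:
  assumes z: "cmod z = 1"
  shows "\<exists>u\<in>carrier_vec m. vnorm u = 1 \<and> H z *\<^sub>v u = u"
proof -
  let ?X = "toep n (proj_coeff n z)"
  have zz: "cnj z ^ j * z ^ j = 1" for j
    using z by (simp add: power_mult_distrib[symmetric] complex_norm_square[symmetric] mult.commute)
  have le: "Re (ip (?X *\<^sub>v v) v) \<le> (vnorm v)\<^sup>2" if v: "v \<in> carrier_vec n" for v
  proof -
    let ?w = "vec n (\<lambda>j. z ^ j)"
    have "ip v ?w = (\<Sum>j<n. cnj z ^ j * v $ j)" using v by (simp add: ip_def mult.commute)
    moreover have "(vnorm ?w)\<^sup>2 = n" using z by (simp add: vnorm_def norm_power)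
    moreover have "(cmod (ip v ?w))\<^sup>2 \<le> (vnorm v * vnorm ?w)\<^sup>2"
      using v by (intro power_mono cauchy_schwarz[of _ n]) auto
    ultimately show ?thesis
      using n_pos by (simp add: form_toep_proj_coeff[OF z v] power_mult_distrib field_simps)
  qed
  obtain u where u: "u \<in> carrier_vec m" "vnorm u = 1"
    and max: "\<And>v. v \<in> carrier_vec m \<Longrightarrow> Re (ip (\<phi> ?X *\<^sub>v v) v) \<le> Re (ip (\<phi> ?X *\<^sub>v u) u) * (vnorm v)\<^sup>2"
    using quadratic_form_attains_max[OF phi_carrier m_pos, of "proj_coeff n z"] by blast
  define c where "c = Re (ip (\<phi> ?X *\<^sub>v u) u)"
  \<comment> \<open>Positivity of \<open>c I - \<phi> X\<close> is pulled back to
    \<open>c I - X\<close> and tested at the vector of powers of \<open>z\<close>, where the form of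
    \<open>X\<close> equals the squared norm \<open>n\<close>.\<close>
  have "0 \<le> Re (ip (toep n (\<lambda>k. complex_of_real c * (if k = 0 then 1 else 0) + (-1) * proj_coeff n z k) *\<^sub>v vec n (\<lambda>j. z ^ j)) (vec n (\<lambda>j. z ^ j)))"
    by (rule toep_form_nonneg) (auto simp only: phi_affine form_affine[OF phi_carrier] max c_def diff_ge_0_iff_ge vec_carrier)
  then have "Re (ip (?X *\<^sub>v vec n (\<lambda>j. z ^ j)) (vec n (\<lambda>j. z ^ j))) \<le> c * (vnorm (vec n (\<lambda>j. z ^ j)))\<^sup>2"
    unfolding toep_affine[symmetric] by (subst (asm) form_affine) auto
  then have c1: "1 \<le> c" using z n_pos
    by (subst (asm) form_toep_proj_coeff[OF z]) (auto simp: vnorm_def zz norm_power power2_eq_square)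
  \<comment> \<open>The Cauchy-Schwarz bound \<open>le\<close> says that \<open>I - X\<close> is
    positive, and so is its image.\<close>
  have le': "Re (ip (\<phi> ?X *\<^sub>v v) v) \<le> (vnorm v)\<^sup>2" if v: "v \<in> carrier_vec m" for v
  proof -
    have "0 \<le> Re (ip (\<phi> (toep n (\<lambda>k. complex_of_real 1 * (if k = 0 then 1 else 0) + (-1) * proj_coeff n z k)) *\<^sub>v v) v)"
    proof (rule phi_form_nonneg[OF _ v])
      fix w :: "complex vec" assume "w \<in> carrier_vec n"
      then show "0 \<le> Re (ip (toep n (\<lambda>k. complex_of_real 1 * (if k = 0 then 1 else 0) + (-1) * proj_coeff n z k) *\<^sub>v w) w)"
        unfolding toep_affine[symmetric] by (subst form_affine) (use le in auto)
    qed
    then show ?thesis unfolding phi_affine by (subst (asm) form_affine) (use v in auto)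
  qed
  define P where "P = complex_of_real 1 \<cdot>\<^sub>m 1\<^sub>m m + (-1) \<cdot>\<^sub>m H z"
  have form: "Re (ip (P *\<^sub>v v) v) = (vnorm v)\<^sup>2 - Re (ip (\<phi> ?X *\<^sub>v v) v)" if "v \<in> carrier_vec m" for v
    unfolding P_def using that by (subst form_affine) (auto simp: H_def ip_herm[of _ m])
  have "P *\<^sub>v u = 0\<^sub>v m"
  proof (rule psd_form_zero_imp_kernel)
    show "P \<in> carrier_mat m m" by (auto simp: P_def)
    show "adj P = P"
    proof (rule eq_matI)
      fix i j assume "i < dim_row P" "j < dim_col P"
      then have ij: "i < m" "j < m" using H_carrier[of z] by (auto simp: P_def)
      have "cnj (H z $$ (j,i)) = H z $$ (i,j)"
        using adj_index[of i "H z" j] ij H_carrier[of z] adj_H by auto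
      then show "adj P $$ (i,j) = P $$ (i,j)" using ij carrier_matD[OF H_carrier[of z]] by (auto simp: P_def)
    qed (auto simp: P_def carrier_matD[OF H_carrier[of z]])
    show "0 \<le> Re (ip (P *\<^sub>v v) v)" if "v \<in> carrier_vec m" for v
      using form[OF that] le'[OF that] by simp
    have "c \<le> 1" using le'[OF u(1)] u(2) by (simp add: c_def)
    then show "Re (ip (P *\<^sub>v u) u) = 0" using form[OF u(1)] c1 u(2) by (simp add: c_def)
  qed (rule u)
  moreover have "P *\<^sub>v u = u + (-1) \<cdot>\<^sub>v (H z *\<^sub>v u)"
    using u unfolding P_def by (simp add: add_mult_distrib_mat_vec[of _ m m] smult_mat_mult_mat_vec[of _ m m])
  ultimately have eq: "u + (-1) \<cdot>\<^sub>v (H z *\<^sub>v u) = 0\<^sub>v m" by simp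
  have Hu: "H z *\<^sub>v u \<in> carrier_vec m" using u by (auto intro: mult_mat_vec_carrier)
  have "H z *\<^sub>v u = u"
  proof (rule eq_vecI)
    fix i assume "i < dim_vec u"
    then have i: "i < m" using u by simp
    have "u $ i - (H z *\<^sub>v u) $ i = (u + (-1) \<cdot>\<^sub>v (H z *\<^sub>v u)) $ i"
      using i u carrier_vecD[OF Hu] by (simp del: index_mult_mat_vec dim_mult_mat_vec)
    also have "\<dots> = 0" using eq i by simp
    finally show "(H z *\<^sub>v u) $ i = u $ i" by simp
  qed (use u carrier_matD(1)[OF H_carrier[of z]] in auto)
  then show ?thesis using u by blast
qed

lemma H_index:
  assumes "r < m" "s < m"
  shows "H z $$ (r,s) = (\<Sum>l<n. proj_coeff n z l * T l $$ (r,s) + cnj (proj_coeff n z l) * cnj (T l $$ (s,r))) / 2"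
  using assms carrier_matD[OF phi_carrier[of "proj_coeff n z"]]
  by (simp add: H_def herm_def phi_toep_index sum.distrib)

section \<open>Averages over the \<open>n\<close>-th roots of the unimodular number
  \<open>\<zeta> ^ n\<close>\<close>

definition root_pt :: "complex \<Rightarrow> nat \<Rightarrow> complex" where
  "root_pt \<zeta> j = \<zeta> * cis (2 * pi * real j / real n)"

lemma cmod_root_pt[simp]: "cmod \<zeta> = 1 \<Longrightarrow> cmod (root_pt \<zeta> j) = 1"
  by (simp add: root_pt_def norm_mult)

lemma root_pt_power: "root_pt \<zeta> j ^ n = \<zeta> ^ n"
proof -
  have "cis (2 * pi * real j / real n) ^ n = 1"
    using n_pos cis_multiple_2pi[of "real j"] by (simp add: DeMoivre)
  then show ?thesis by (simp add: root_pt_def power_mult_distrib)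
qed

text \<open>The exponent \<open>k + l\<close> is below \<open>2 n\<close>, so \<open>n\<close>
  divides it only when it is 0 or \<open>n\<close>.\<close>

lemma sum_root_pt_mult:
  assumes "k \<le> n" "l < n"
  shows "(\<Sum>j<n. root_pt \<zeta> j ^ k * root_pt \<zeta> j ^ l) =
     of_nat n * ((if k = 0 \<and> l = 0 then 1 else 0) + (if k + l = n then \<zeta> ^ n else 0))"
proof -
  have "(\<Sum>j<n. root_pt \<zeta> j ^ k * root_pt \<zeta> j ^ l) = (if n dvd k + l then of_nat n * \<zeta> ^ (k + l) else 0)"
    using sum_powers_of_roots[OF n_pos, of \<zeta> "k + l"] by (simp add: root_pt_def power_add)
  moreover have "n dvd k + l \<longleftrightarrow> k + l = 0 \<or> k + l = n"
  proof
    assume "n dvd k + l"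
    then obtain d where d: "k + l = n * d" by auto
    then have "n * d < n * 2" using assms by linarith
    then have "d < 2" by (simp only: mult_less_cancel1)
    then show "k + l = 0 \<or> k + l = n" using d by (cases d) auto
  qed auto
  ultimately show ?thesis using n_pos by auto
qed

text \<open>Since all points have the same \<open>n\<close>-th power, \<open>cnj\<close> of a point
  to the power \<open>l\<close> is the point to the power \<open>n - l\<close> times
  \<open>cnj \<zeta> ^ n\<close>. This leaves a sum of powers with exponent between 1 and
  \<open>2 n\<close>.\<close>

lemma sum_root_pt_mult_cnj:
  assumes "k \<le> n" "l < n" and \<zeta>: "cmod \<zeta> = 1"
  shows "(\<Sum>j<n. root_pt \<zeta> j ^ k * cnj (root_pt \<zeta> j) ^ l) =
     of_nat n * ((if k = l then 1 else 0) + (if k = n \<and> l = 0 then \<zeta> ^ n else 0))"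
proof -
  have \<zeta>1: "\<zeta> * cnj \<zeta> = 1" using \<zeta> by (simp add: complex_norm_square[symmetric])
  have \<zeta>n: "\<zeta> ^ n * cnj \<zeta> ^ n = 1" using \<zeta>1 by (simp add: power_mult_distrib[symmetric])
  have "root_pt \<zeta> j ^ k * cnj (root_pt \<zeta> j) ^ l = root_pt \<zeta> j ^ (k + (n - l)) * cnj \<zeta> ^ n" for j
  proof -
    have "root_pt \<zeta> j * cnj (root_pt \<zeta> j) = 1" using \<zeta> by (simp add: complex_norm_square[symmetric])
    then have 1: "root_pt \<zeta> j ^ d * cnj (root_pt \<zeta> j) ^ d = 1" for d by (simp add: power_mult_distrib[symmetric])
    have "cnj \<zeta> ^ n = cnj (root_pt \<zeta> j) ^ n" using root_pt_power[of \<zeta> j] by (metis complex_cnj_power)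
    also have "\<dots> = cnj (root_pt \<zeta> j) ^ l * cnj (root_pt \<zeta> j) ^ (n - l)"
      using assms by (simp add: power_add[symmetric])
    finally show ?thesis using 1[of "n - l"] by (simp add: power_add mult_ac)
  qed
  then have "(\<Sum>j<n. root_pt \<zeta> j ^ k * cnj (root_pt \<zeta> j) ^ l) = (\<Sum>j<n. root_pt \<zeta> j ^ (k + (n - l))) * cnj \<zeta> ^ n"
    by (simp add: sum_distrib_right)
  also have "(\<Sum>j<n. root_pt \<zeta> j ^ (k + (n - l))) = (if n dvd k + (n - l) then of_nat n * \<zeta> ^ (k + (n - l)) else 0)"
    using sum_powers_of_roots[OF n_pos, of \<zeta> "k + (n - l)"] by (simp add: root_pt_def)
  also have "n dvd k + (n - l) \<longleftrightarrow> k = l \<or> (k = n \<and> l = 0)"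
  proof
    assume "n dvd k + (n - l)"
    then obtain d where d: "k + (n - l) = n * d" by auto
    then have "n * d \<le> n * 2" "0 < n * d" using assms by linarith+
    then have "d \<le> 2" "0 < d" using n_pos by (auto simp only: mult_le_cancel1 nat_0_less_mult_iff)
    then have "d = 1 \<or> d = 2" by auto
    then show "k = l \<or> (k = n \<and> l = 0)" using d assms by auto
  next
    assume "k = l \<or> (k = n \<and> l = 0)"
    then have "k + (n - l) = n \<or> k + (n - l) = n + n" using assms by auto
    then show "n dvd k + (n - l)" by auto
  qed
  finally show ?thesis using \<zeta>n assms by (auto simp: power_add mult_ac)
qed

text \<open>Discrete Fourier inversion: weighting the \<open>H\<close> by \<open>k\<close>-th powers
  isolates one image of a shift power and one adjoint. For \<open>k = 0\<close> the right side is
  the identity, because \<open>T n = 0\<close>.\<close>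

lemma sum_root_pt_H:
  assumes k: "k \<le> n" and rs: "r < m" "s < m" and \<zeta>: "cmod \<zeta> = 1"
  shows "(\<Sum>j<n. root_pt \<zeta> j ^ k * H (root_pt \<zeta> j) $$ (r,s)) = T k $$ (r,s) + \<zeta> ^ n * cnj (T (n - k) $$ (s,r))"
proof -
  \<comment> \<open>The weights of \<open>proj_coeff\<close>: single on the diagonal, double off
    it.\<close>
  define w where "w l = (if l = 0 then 1 else 2 :: complex)" for l :: nat
  define a where "a l = T l $$ (r,s)" for l
  define b where "b l = cnj (T l $$ (s,r))" for l
  define N where "N = complex_of_nat n"
  have N: "N \<noteq> 0" using n_pos by (simp add: N_def)
  have wn: "proj_coeff n z l = w l * cnj z ^ l / N" "cnj (proj_coeff n z l) = w l * z ^ l / N" for z l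
    by (auto simp: proj_coeff_def w_def N_def)
  have "(\<Sum>j<n. root_pt \<zeta> j ^ k * H (root_pt \<zeta> j) $$ (r,s)) =
      (\<Sum>j<n. \<Sum>l<n. w l / (2 * N) * (a l * (root_pt \<zeta> j ^ k * cnj (root_pt \<zeta> j) ^ l) + b l * (root_pt \<zeta> j ^ k * root_pt \<zeta> j ^ l)))"
    unfolding H_index[OF rs] wn(2) unfolding wn(1) using N
    by (intro sum.cong refl) (simp add: sum_distrib_left sum_divide_distrib a_def b_def field_simps)
  also have "\<dots> = (\<Sum>l<n. w l / (2 * N) * (a l * (\<Sum>j<n. root_pt \<zeta> j ^ k * cnj (root_pt \<zeta> j) ^ l) + b l * (\<Sum>j<n. root_pt \<zeta> j ^ k * root_pt \<zeta> j ^ l)))"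
    by (subst sum.swap) (simp add: sum_distrib_left sum.distrib algebra_simps)
  also have "\<dots> = (\<Sum>l<n. w l / 2 * (a l * ((if k = l then 1 else 0) + (if k = n \<and> l = 0 then \<zeta> ^ n else 0)) + b l * ((if k = 0 \<and> l = 0 then 1 else 0) + (if k + l = n then \<zeta> ^ n else 0))))"
  proof (intro sum.cong refl)
    fix l assume "l \<in> {..<n}"
    then have l: "l < n" by simp
    have cancel: "w l / (2 * N) * (a l * (N * p) + b l * (N * q)) = w l / 2 * (a l * p + b l * q)" for p q
      using N by (simp add: field_simps)
    show "w l / (2 * N) * (a l * (\<Sum>j<n. root_pt \<zeta> j ^ k * cnj (root_pt \<zeta> j) ^ l) + b l * (\<Sum>j<n. root_pt \<zeta> j ^ k * root_pt \<zeta> j ^ l)) =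
      w l / 2 * (a l * ((if k = l then 1 else 0) + (if k = n \<and> l = 0 then \<zeta> ^ n else 0)) + b l * ((if k = 0 \<and> l = 0 then 1 else 0) + (if k + l = n then \<zeta> ^ n else 0)))"
      unfolding sum_root_pt_mult_cnj[OF k l \<zeta>] sum_root_pt_mult[OF k l] N_def[symmetric] by (rule cancel)
  qed
  also have "\<dots> = (\<Sum>l<n. (if l = k then w l / 2 * a l else 0) + (if l = 0 then (if k = n then \<zeta> ^ n else 0) * (w 0 / 2 * a 0) + (if k = 0 then w 0 / 2 * b 0 else 0) else 0)
       + (if l = n - k then w l / 2 * b l * \<zeta> ^ n else 0))"
    using k by (intro sum.cong refl) (auto simp: algebra_simps)
  also have "\<dots> = (if k < n then w k / 2 * a k else 0) + ((if k = n then \<zeta> ^ n else 0) * (w 0 / 2 * a 0) + (if k = 0 then w 0 / 2 * b 0 else 0)) + (if 0 < k then w (n - k) / 2 * b (n - k) * \<zeta> ^ n else 0)"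
    unfolding sum.distrib using n_pos k by (simp add: sum.delta)
  also have "\<dots> = a k + \<zeta> ^ n * b (n - k)"
  proof -
    \<comment> \<open>At the ends \<open>k = 0\<close> and \<open>k = n\<close> two halves with
      index 0 combine into one full term, while the terms with index \<open>n\<close>
      vanish.\<close>
    have ab: "a 0 = b 0" using rs by (simp add: a_def b_def T_0)
    have z: "a n = 0" "b n = 0" using T_eq_0[of n] rs by (simp_all add: a_def b_def)
    consider "k = 0" | "0 < k" "k < n" | "k = n" using k by linarith
    then show ?thesis using ab z n_pos by cases (auto simp: w_def)
  qed
  finally show ?thesis by (simp add: a_def b_def)
qed

text \<open>At the fixed vector of the \<open>j\<close>-th matrix the nonnegative forms add up to 1
  and the \<open>j\<close>-th form alone is already 1. The others therefore vanish there, so their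
  matrices kill this vector, and hermiticity yields orthogonality.\<close>

lemma exists_eigenbasis:
  assumes \<zeta>: "cmod \<zeta> = 1"
  shows "\<exists>u. orthonormal_family m n u \<and> (\<forall>i<n. \<forall>j<n. H (root_pt \<zeta> i) *\<^sub>v u j = (if i = j then u j else 0\<^sub>v m))"
proof -
  define u where "u j = (SOME u. u \<in> carrier_vec m \<and> vnorm u = 1 \<and> H (root_pt \<zeta> j) *\<^sub>v u = u)" for j
  have u: "u j \<in> carrier_vec m \<and> vnorm (u j) = 1 \<and> H (root_pt \<zeta> j) *\<^sub>v u j = u j" for j
    unfolding u_def by (rule someI_ex) (use H_fixed_vector[OF cmod_root_pt[OF \<zeta>], of j] in blast)
  define h where "h i j = Re (ip (H (root_pt \<zeta> i) *\<^sub>v u j) (u j))" for i j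
  have h0: "0 \<le> h i j" for i j
    unfolding h_def using H_nonneg[OF cmod_root_pt[OF \<zeta>]] u by blast
  have hjj: "h j j = 1" for j using u[of j] by (simp add: h_def ip_self)
  \<comment> \<open>The matrices \<open>H\<close> at the \<open>n\<close> roots add up to the
    identity, by \<open>sum_root_pt_H\<close> with \<open>k = 0\<close>.\<close>
  have hsum: "(\<Sum>i<n. h i j) = 1" for j
  proof -
    have uj: "u j \<in> carrier_vec m" using u by blast
    have "(\<Sum>i<n. ip (H (root_pt \<zeta> i) *\<^sub>v u j) (u j)) = (\<Sum>i<n. \<Sum>r<m. \<Sum>s<m. H (root_pt \<zeta> i) $$ (r,s) * u j $ s * cnj (u j $ r))"
      using uj by (auto simp: ip_def mult_mat_vec_index[OF H_carrier uj] sum_distrib_right simp del: index_mult_mat_vec)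
    also have "\<dots> = (\<Sum>r<m. \<Sum>s<m. \<Sum>i<n. H (root_pt \<zeta> i) $$ (r,s) * u j $ s * cnj (u j $ r))"
      by (subst sum.swap) (intro sum.cong refl sum.swap)
    also have "\<dots> = (\<Sum>r<m. \<Sum>s<m. (if r = s then 1 else 0) * u j $ s * cnj (u j $ r))"
    proof (intro sum.cong refl)
      fix r s assume "r \<in> {..<m}" "s \<in> {..<m}"
      then have rs: "r < m" "s < m" by auto
      have "(\<Sum>i<n. H (root_pt \<zeta> i) $$ (r,s)) = (if r = s then 1 else 0)"
        using sum_root_pt_H[of 0 r s \<zeta>] rs \<zeta> T_eq_0[of n] by (simp add: T_0)
      then show "(\<Sum>i<n. H (root_pt \<zeta> i) $$ (r,s) * u j $ s * cnj (u j $ r)) = (if r = s then 1 else 0) * u j $ s * cnj (u j $ r)"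
        by (simp add: sum_distrib_right[symmetric])
    qed
    also have "\<dots> = (\<Sum>r<m. u j $ r * cnj (u j $ r))"
      by (intro sum.cong refl) (simp add: if_distrib[of "\<lambda>x. x * _"] cong: if_cong)
    also have "\<dots> = ip (u j) (u j)" using uj by (simp add: ip_def)
    also have "\<dots> = 1" using u[of j] by (simp add: ip_self)
    finally have "Re (\<Sum>i<n. ip (H (root_pt \<zeta> i) *\<^sub>v u j) (u j)) = 1" by simp
    then show ?thesis by (simp add: h_def)
  qed
  have Hz: "H (root_pt \<zeta> i) *\<^sub>v u j = 0\<^sub>v m" if ij: "i < n" "j < n" "i \<noteq> j" for i j
  proof -
    have "h i j + h j j \<le> (\<Sum>i<n. h i j)"
      using sum_mono2[of "{..<n}" "{i,j}" "\<lambda>i. h i j"] ij h0 by simp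
    then have "h i j = 0" using hsum hjj h0[of i j] by (simp add: antisym)
    then show ?thesis
      using u[of j] H_nonneg[OF cmod_root_pt[OF \<zeta>]] by (intro psd_form_zero_imp_kernel[OF H_carrier adj_H]) (auto simp: h_def)
  qed
  have "ip (u i) (u j) = 0" if ij: "i < n" "j < n" "i \<noteq> j" for i j
  proof -
    have c: "u i \<in> carrier_vec m" "u j \<in> carrier_vec m" using u by auto
    have "ip (u i) (u j) = ip (H (root_pt \<zeta> i) *\<^sub>v u i) (u j)" using u by simp
    also have "\<dots> = ip (u i) (H (root_pt \<zeta> i) *\<^sub>v u j)" by (simp add: ip_adj[OF H_carrier c] adj_H)
    also have "\<dots> = 0" using Hz[OF ij] c by simp
    finally show ?thesis .
  qed
  then have "orthonormal_family m n u" using u by (auto simp: orthonormal_family_def ip_self)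
  then show ?thesis using Hz u by (intro exI[of _ u]) auto
qed

lemma dim_le: "n \<le> m"
  using exists_eigenbasis[of 1] orthonormal_card_le by auto

end

section \<open>The case of equal dimensions\<close>

lemma mult_mat_of_family_index:
  assumes A: "A \<in> carrier_mat r m" and e: "e j \<in> carrier_vec m" and ij: "i < r" "j < k"
  shows "(A * mat_of_family m k e) $$ (i,j) = (A *\<^sub>v e j) $ i"
proof -
  have "(A * mat_of_family m k e) $$ (i,j) = (\<Sum>l<m. A $$ (i,l) * e j $ l)"
    using ij A by (subst mult_mat_index[of _ r m _ k]) (auto simp: mat_of_family_def)
  then show ?thesis using ij by (simp add: mult_mat_vec_index[OF A e] del: index_mult_mat_vec)
qed

lemma unitary_mult_cancel:
  assumes U: "unitary_mat m U" and A: "A \<in> carrier_mat r m"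
  shows "A * U * adj U = A"
  using assms assoc_mult_mat[of A r m U m "adj U" m] by (auto simp: unitary_mat_def)

lemma mat_eq_on_orthonormal_basis:
  assumes e: "orthonormal_family m m e" and A: "A \<in> carrier_mat r m" and B: "B \<in> carrier_mat r m"
    and eq: "\<And>j. j < m \<Longrightarrow> A *\<^sub>v e j = B *\<^sub>v e j"
  shows "A = B"
proof -
  let ?U = "mat_of_family m m e"
  have ec: "e j \<in> carrier_vec m" if "j < m" for j using e that by (auto simp: orthonormal_family_def)
  have "A * ?U = B * ?U"
    using A B eq by (intro eq_matI) (auto simp: mult_mat_of_family_index[OF _ ec] simp del: index_mult_mat(1))
  then show ?thesis using unitary_mult_cancel[OF orthonormal_unitary[OF e]] A B by metis
qed

section \<open>Norms of the powers of the shift\<close>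

lemma toep_delta_mult_vec_index:
  assumes v: "v \<in> carrier_vec n" and i: "i < n"
  shows "(toep n (\<lambda>l. if l = k then 1 else 0) *\<^sub>v v) $ i = (if i + k < n then v $ (i + k) else 0)"
proof -
  have "(toep n (\<lambda>l. if l = k then 1 else 0) *\<^sub>v v) $ i = (\<Sum>j<n. if j = i + k then v $ j else 0)"
    unfolding mult_mat_vec_index[OF toep_carrier v i] using i by (intro sum.cong) (auto simp: toep_def)
  then show ?thesis by simp
qed

lemma opnorm_toep_delta_le: "opnorm (toep n (\<lambda>l. if l = k then 1 else 0)) \<le> 1"
proof (rule opnorm_le[OF toep_carrier])
  fix v :: "complex vec" assume v: "v \<in> carrier_vec n"
  have "(vnorm (toep n (\<lambda>l. if l = k then 1 else 0) *\<^sub>v v))\<^sup>2 =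
      (\<Sum>i<n. (cmod ((toep n (\<lambda>l. if l = k then 1 else 0) *\<^sub>v v) $ i))\<^sup>2)"
    by (simp add: vnorm_def sum_nonneg toep_def del: index_mult_mat_vec)
  also have "\<dots> = (\<Sum>i<n. if i + k < n then (cmod (v $ (i + k)))\<^sup>2 else 0)"
    by (intro sum.cong) (auto simp: toep_delta_mult_vec_index[OF v] simp del: index_mult_mat_vec)
  also have "\<dots> = (\<Sum>i\<in>{0..<n-k}. (cmod (v $ (i + k)))\<^sup>2)"
    by (rule sum.mono_neutral_cong_right) auto
  also have "\<dots> = (\<Sum>i\<in>{0+k..<(n-k)+k}. (cmod (v $ i))\<^sup>2)"
    by (rule sum.shift_bounds_nat_ivl[symmetric])
  also have "\<dots> \<le> (\<Sum>i<n. (cmod (v $ i))\<^sup>2)"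
    by (rule sum_mono2) auto
  also have "\<dots> = (vnorm v)\<^sup>2" using v by (simp add: vnorm_def sum_nonneg)
  finally show "vnorm (toep n (\<lambda>l. if l = k then 1 else 0) *\<^sub>v v) \<le> 1 * vnorm v"
    using power2_le_imp_le[OF _ vnorm_nonneg] by simp
qed simp

lemma opnorm_toep_delta_ge:
  assumes n: "0 < n"
  shows "1 \<le> opnorm (toep n (\<lambda>l. if l = n - 1 then 1 else 0))"
proof -
  let ?A = "toep n (\<lambda>l. if l = n - 1 then 1 else 0)"
  have norm: "vnorm (unit_vec n i) = 1" if "i < n" for i
    using that by (simp add: vnorm_def unit_vec_def if_distrib[of cmod] if_distrib[of "\<lambda>x. x\<^sup>2"] cong: if_cong)
  have "?A *\<^sub>v unit_vec n (n - 1) = unit_vec n 0"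
  proof (rule eq_vecI)
    fix i assume "i < dim_vec (unit_vec n 0 :: complex vec)"
    then show "(?A *\<^sub>v unit_vec n (n - 1)) $ i = unit_vec n 0 $ i"
      using n by (subst toep_delta_mult_vec_index) auto
  qed (auto simp: toep_def)
  then show ?thesis using vnorm_mult_le_opnorm[of ?A n n "unit_vec n (n - 1)"] norm n by simp
qed

text \<open>Comparison of the constant coefficient in \<open>w\<close>; the three points 1, -1 and
  \<open>\<i>\<close> suffice.\<close>

lemma quadratic_vanishes_on_circle:
  fixes a b c :: complex
  assumes "\<And>w. cmod w = 1 \<Longrightarrow> a + w * b + w * (w * c) = 0"
  shows "a = 0"
proof -
  have 1: "a + b + c = 0" "a - b + c = 0" "a + \<i> * b - c = 0"
    using assms[of 1] assms[of "-1"] assms[of \<i>] by (auto simp: mult.assoc[symmetric])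
  then have "a + b = a - b" by (metis add_right_cancel)
  then have "b = 0" by simp
  then have "a + c = 0" "a - c = 0" using 1 by auto
  then have "2 * a = 0" by (simp add: algebra_simps)
  then show ?thesis by simp
qed

section \<open>Multiplicativity on shift powers and the shift basis when
  \<open>m = n\<close>\<close>

context toeplitz_isometry
begin

text \<open>By \<open>sum_root_pt_H\<close> the matrix is the combination of the \<open>H\<close>
  with \<open>k\<close>-th powers as weights, and at \<open>u\<close> only the \<open>j\<close>-th
  summand survives.\<close>

lemma circulant_eigenvector:
  assumes k: "k \<le> n" and \<zeta>: "cmod \<zeta> = 1" and j: "j < n" and u: "u \<in> carrier_vec m"
    and H: "\<And>i. i < n \<Longrightarrow> H (root_pt \<zeta> i) *\<^sub>v u = (if i = j then u else 0\<^sub>v m)"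
  shows "(T k + \<zeta> ^ n \<cdot>\<^sub>m adj (T (n - k))) *\<^sub>v u = root_pt \<zeta> j ^ k \<cdot>\<^sub>v u"
proof (rule eq_vecI)
  let ?M = "T k + \<zeta> ^ n \<cdot>\<^sub>m adj (T (n - k))"
  have M: "?M \<in> carrier_mat m m" by auto
  fix r assume "r < dim_vec (root_pt \<zeta> j ^ k \<cdot>\<^sub>v u)"
  then have r: "r < m" using u by simp
  have "(?M *\<^sub>v u) $ r = (\<Sum>s<m. (\<Sum>i<n. root_pt \<zeta> i ^ k * H (root_pt \<zeta> i) $$ (r,s)) * u $ s)"
    unfolding mult_mat_vec_index[OF M u r]
  proof (intro sum.cong refl)
    fix s assume "s \<in> {..<m}"
    then show "?M $$ (r,s) * u $ s = (\<Sum>i<n. root_pt \<zeta> i ^ k * H (root_pt \<zeta> i) $$ (r,s)) * u $ s"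
      using r carrier_matD[OF T_carrier[of k]] carrier_matD[OF T_carrier[of "n - k"]]
      by (simp add: sum_root_pt_H[OF k _ _ \<zeta>])
  qed
  also have "\<dots> = (\<Sum>s<m. \<Sum>i<n. root_pt \<zeta> i ^ k * (H (root_pt \<zeta> i) $$ (r,s) * u $ s))"
    by (simp add: sum_distrib_right mult.assoc)
  also have "\<dots> = (\<Sum>i<n. root_pt \<zeta> i ^ k * (H (root_pt \<zeta> i) *\<^sub>v u) $ r)"
    by (subst sum.swap) (simp add: sum_distrib_left mult_mat_vec_index[OF H_carrier u r] del: index_mult_mat_vec)
  also have "\<dots> = (\<Sum>i<n. if i = j then root_pt \<zeta> j ^ k * u $ r else 0)"
    using r by (intro sum.cong refl) (simp add: H del: index_mult_mat_vec)
  also have "\<dots> = (root_pt \<zeta> j ^ k \<cdot>\<^sub>v u) $ r" using j r u by simp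
  finally show "(?M *\<^sub>v u) $ r = (root_pt \<zeta> j ^ k \<cdot>\<^sub>v u) $ r" .
qed (use u carrier_matD[OF T_carrier] in auto)

text \<open>With \<open>m = n\<close> the eigenvectors form a basis, on which the matrices
  \<open>T k + w \<cdot>\<^sub>m D k\<close> act by \<open>k\<close>-th powers; hence the one for 1
  times the one for \<open>k\<close> is the one for \<open>Suc k\<close>. Both sides are polynomials
  in \<open>w\<close>, and their constant terms give the claim.\<close>

lemma T_Suc_aux:
  assumes mn: "m = n" and k: "k < n"
  shows "T 1 * T k = T (Suc k)"
proof (rule eq_matI)
  fix r s assume "r < dim_row (T (Suc k))" "s < dim_col (T (Suc k))"
  then have rs: "r < m" "s < m" using carrier_matD[OF T_carrier] by auto
  define D where "D k = adj (T (n - k))" for k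
  have D: "D k \<in> carrier_mat m m" for k by (auto simp: D_def)
  have "(T 1 * T k) $$ (r,s) - T (Suc k) $$ (r,s) + w * ((T 1 * D k + D 1 * T k) $$ (r,s) - D (Suc k) $$ (r,s))
       + w * (w * (D 1 * D k) $$ (r,s)) = 0" if w: "cmod w = 1" for w
  proof -
    obtain t where t: "w = cis t" using rcis_cmod_Arg[of w] w by (metis rcis_def of_real_1 mult_1)
    \<comment> \<open>An \<open>n\<close>-th root of \<open>w\<close> on the unit circle, so that
      the identity is available for every unimodular \<open>w\<close>.\<close>
    define \<zeta> where "\<zeta> = cis (t / n)"
    have \<zeta>: "cmod \<zeta> = 1" "\<zeta> ^ n = w" using n_pos by (auto simp: \<zeta>_def t DeMoivre)
    obtain u where u: "orthonormal_family m n u" and Hu: "\<And>i j. i < n \<Longrightarrow> j < n \<Longrightarrow> H (root_pt \<zeta> i) *\<^sub>v u j = (if i = j then u j else 0\<^sub>v m)"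
      using exists_eigenbasis[OF \<zeta>(1)] by blast
    have uc: "u j \<in> carrier_vec m" if "j < n" for j using u that by (auto simp: orthonormal_family_def)
    have ev: "(T k + w \<cdot>\<^sub>m D k) *\<^sub>v u j = root_pt \<zeta> j ^ k \<cdot>\<^sub>v u j" if "k \<le> n" "j < n" for k j
      using circulant_eigenvector[OF that(1) \<zeta>(1) that(2) uc[OF that(2)] Hu[OF _ that(2)]] \<zeta>(2) by (simp add: D_def)
    have C: "T k + w \<cdot>\<^sub>m D k \<in> carrier_mat m m" for k using D[of k] T_carrier[of k] by auto
    have eq: "(T 1 + w \<cdot>\<^sub>m D 1) * (T k + w \<cdot>\<^sub>m D k) = T (Suc k) + w \<cdot>\<^sub>m D (Suc k)"
    proof (rule mat_eq_on_orthonormal_basis)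
      show "orthonormal_family m m u" using u mn by simp
      fix j assume "j < m"
      then have j: "j < n" using mn by simp
      have "((T 1 + w \<cdot>\<^sub>m D 1) * (T k + w \<cdot>\<^sub>m D k)) *\<^sub>v u j = (T 1 + w \<cdot>\<^sub>m D 1) *\<^sub>v ((T k + w \<cdot>\<^sub>m D k) *\<^sub>v u j)"
        using uc[OF j] by (rule assoc_mult_mat_vec[OF C C])
      also have "\<dots> = root_pt \<zeta> j ^ k \<cdot>\<^sub>v (root_pt \<zeta> j ^ 1 \<cdot>\<^sub>v u j)"
        using k j n_pos ev[of k j] ev[of 1 j] uc[OF j] by (simp only: less_imp_le mult_mat_vec[OF C uc[OF j]])
      also have "\<dots> = (T (Suc k) + w \<cdot>\<^sub>m D (Suc k)) *\<^sub>v u j"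
        using k j ev[of "Suc k" j] by (simp add: smult_smult_assoc mult.commute)
      finally show "((T 1 + w \<cdot>\<^sub>m D 1) * (T k + w \<cdot>\<^sub>m D k)) *\<^sub>v u j = (T (Suc k) + w \<cdot>\<^sub>m D (Suc k)) *\<^sub>v u j" .
    qed (rule mult_carrier_mat[OF C C], rule C)
    have "((T 1 + w \<cdot>\<^sub>m D 1) * (T k + w \<cdot>\<^sub>m D k)) $$ (r,s) =
        (T 1 * T k) $$ (r,s) + w * ((T 1 * D k + D 1 * T k) $$ (r,s)) + w * (w * (D 1 * D k) $$ (r,s))"
    proof -
      note Tm = carrier_matD[OF T_carrier] and Dm = carrier_matD[OF D]
      have "((T 1 + w \<cdot>\<^sub>m D 1) * (T k + w \<cdot>\<^sub>m D k)) $$ (r,s) =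
        (\<Sum>l<m. (T 1 $$ (r,l) + w * D 1 $$ (r,l)) * (T k $$ (l,s) + w * D k $$ (l,s)))"
        using rs Tm Dm by (subst mult_mat_index[OF C C rs]) (auto intro!: sum.cong)
      also have "\<dots> = (T 1 * T k) $$ (r,s) + w * ((T 1 * D k) $$ (r,s) + (D 1 * T k) $$ (r,s)) + w * (w * (D 1 * D k) $$ (r,s))"
        unfolding mult_mat_index[OF T_carrier T_carrier rs] mult_mat_index[OF T_carrier D rs]
          mult_mat_index[OF D T_carrier rs] mult_mat_index[OF D D rs]
        by (simp add: sum_distrib_left sum.distrib algebra_simps)
      finally show ?thesis using rs Tm Dm by simp
    qed
    moreover have "(T (Suc k) + w \<cdot>\<^sub>m D (Suc k)) $$ (r,s) = T (Suc k) $$ (r,s) + w * D (Suc k) $$ (r,s)"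
      using rs carrier_matD[OF T_carrier[of "Suc k"]] carrier_matD[OF D[of "Suc k"]] by simp
    ultimately show ?thesis unfolding eq by (simp add: algebra_simps)
  qed
  then have "(T 1 * T k) $$ (r,s) - T (Suc k) $$ (r,s) = 0" by (rule quadratic_vanishes_on_circle)
  then show "(T 1 * T k) $$ (r,s) = T (Suc k) $$ (r,s)" by simp
qed (use carrier_matD[OF T_carrier] in auto)

lemma T_Suc:
  assumes mn: "m = n"
  shows "T (Suc k) = T 1 * T k"
proof (cases "k < n")
  case True
  then show ?thesis using T_Suc_aux[OF mn] by simp
next
  case False
  then show ?thesis using T_eq_0[of k] T_eq_0[of "Suc k"] right_mult_zero_mat[OF T_carrier, of 1 m] by simp
qed

lemma T_add:
  assumes mn: "m = n"
  shows "T (i + j) = T i * T j"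
proof (induction i)
  case 0
  show ?case using left_mult_one_mat[OF T_carrier] by (simp add: T_0)
next
  case (Suc i)
  have "T (Suc i + j) = T 1 * (T i * T j)" using T_Suc[OF mn, of "i + j"] Suc by simp
  also have "\<dots> = T (Suc i) * T j"
    unfolding T_Suc[OF mn, of i] by (rule assoc_mult_mat[symmetric, OF T_carrier T_carrier T_carrier])
  finally show ?case .
qed

lemma phi_form:
  assumes v: "v \<in> carrier_vec m" and w: "w \<in> carrier_vec m"
  shows "ip (\<phi> (toep n a) *\<^sub>v v) w = (\<Sum>k<n. a k * ip (T k *\<^sub>v v) w)"
proof -
  have "ip (\<phi> (toep n a) *\<^sub>v v) w = (\<Sum>r<m. \<Sum>s<m. \<Sum>k<n. a k * (T k $$ (r,s) * v $ s * cnj (w $ r)))"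
    using w by (auto simp: ip_def mult_mat_vec_index[OF phi_carrier v] phi_toep_index sum_distrib_right sum_distrib_left mult_ac simp del: index_mult_mat_vec intro!: sum.cong)
  also have "\<dots> = (\<Sum>r<m. \<Sum>k<n. \<Sum>s<m. a k * (T k $$ (r,s) * v $ s * cnj (w $ r)))"
    by (intro sum.cong refl sum.swap)
  also have "\<dots> = (\<Sum>k<n. \<Sum>r<m. \<Sum>s<m. a k * (T k $$ (r,s) * v $ s * cnj (w $ r)))"
    by (rule sum.swap)
  also have "\<dots> = (\<Sum>k<n. a k * ip (T k *\<^sub>v v) w)"
    using w by (auto simp: ip_def mult_mat_vec_index[OF T_carrier v] sum_distrib_left sum_distrib_right simp del: index_mult_mat_vec intro!: sum.cong)
  finally show ?thesis .
qed

lemma vnorm_T_le: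
  assumes v: "v \<in> carrier_vec m"
  shows "vnorm (T k *\<^sub>v v) \<le> vnorm v"
proof -
  have "opnorm (T k) \<le> 1"
    using isom[OF toep_in] opnorm_toep_delta_le[of n k] by (simp add: T_def)
  then have "opnorm (T k) * vnorm v \<le> 1 * vnorm v" by (intro mult_right_mono) auto
  then show ?thesis using vnorm_mult_le_opnorm[OF T_carrier v, of k] by simp
qed

text \<open>The form of \<open>adj ?B * ?B\<close> is the squared norm of the image vector, so its
  maximum is attained where \<open>?B\<close> attains its operator norm, and that norm is at least 1
  because the map is isometric.\<close>

lemma exists_norming_vector: "\<exists>f\<in>carrier_vec m. vnorm f = 1 \<and> 1 \<le> vnorm (T (n - 1) *\<^sub>v f)"
proof -
  let ?B = "T (n - 1)"
  have B: "adj ?B * ?B \<in> carrier_mat m m" by (auto intro: mult_carrier_mat)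
  have form: "Re (ip (adj ?B * ?B *\<^sub>v v) v) = (vnorm (?B *\<^sub>v v))\<^sup>2" if v: "v \<in> carrier_vec m" for v
  proof -
    have "adj ?B * ?B *\<^sub>v v = adj ?B *\<^sub>v (?B *\<^sub>v v)"
      using v by (intro assoc_mult_mat_vec[of _ m m _ m]) auto
    then show ?thesis using ip_adj[of "adj ?B" m m "?B *\<^sub>v v" v] v mult_mat_vec_carrier[OF T_carrier v]
      by (simp add: vnorm_square)
  qed
  obtain f where f: "f \<in> carrier_vec m" "vnorm f = 1"
    and max: "\<And>v. v \<in> carrier_vec m \<Longrightarrow> Re (ip (adj ?B * ?B *\<^sub>v v) v) \<le> Re (ip (adj ?B * ?B *\<^sub>v f) f) * (vnorm v)\<^sup>2"
    using quadratic_form_attains_max[OF B m_pos] by blast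
  have "opnorm ?B \<le> vnorm (?B *\<^sub>v f)"
  proof (rule opnorm_le[OF T_carrier])
    fix v :: "complex vec" assume v: "v \<in> carrier_vec m"
    have "(vnorm (?B *\<^sub>v v))\<^sup>2 \<le> (vnorm (?B *\<^sub>v f) * vnorm v)\<^sup>2"
      using max[OF v] form[OF v] form[OF f(1)] by (simp add: power_mult_distrib)
    then show "vnorm (?B *\<^sub>v v) \<le> vnorm (?B *\<^sub>v f) * vnorm v" by (rule power2_le_imp_le) simp
  qed simp
  moreover have "1 \<le> opnorm ?B"
    using isom[OF toep_in] opnorm_toep_delta_ge[OF n_pos] by (simp add: T_def)
  ultimately show ?thesis using f by force
qed

text \<open>The orbit of a norming vector \<open>f\<close> under the matrices \<open>T j\<close> is
  orthonormal. Contractivity squeezes all norms to 1 between the first and the last vector, and the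
  adjoint of an isometric step moves any inner product past the end of the orbit, where it is
  0.\<close>

lemma exists_shift_basis:
  assumes mn: "m = n"
  shows "\<exists>e. orthonormal_family n n e \<and> (\<forall>a. \<forall>i<n. \<forall>j<n. ip (\<phi> (toep n a) *\<^sub>v e j) (e i) = toep n a $$ (i,j))"
proof -
  obtain f where f: "f \<in> carrier_vec m" "vnorm f = 1" "1 \<le> vnorm (T (n - 1) *\<^sub>v f)"
    using exists_norming_vector by blast
  define g where "g j = T j *\<^sub>v f" for j
  have g: "g j \<in> carrier_vec m" for j using f(1) by (auto simp: g_def intro: mult_mat_vec_carrier)
  have Tg: "T i *\<^sub>v g j = g (i + j)" for i j
    using assoc_mult_mat_vec[OF T_carrier[of i] T_carrier[of j] f(1)] by (simp add: g_def T_add[OF mn])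
  have g0: "g j = 0\<^sub>v m" if "n \<le> j" for j
    using T_eq_0[OF that] f(1) by (intro eq_vecI) (auto simp: g_def)
  have gn: "vnorm (g j) = 1" if j: "j < n" for j
  proof (rule antisym)
    show "vnorm (g j) \<le> 1" using vnorm_T_le[OF f(1)] f(2) by (simp add: g_def)
    have "g (n - 1) = T (n - 1 - j) *\<^sub>v g j" using j by (simp add: Tg)
    then have "vnorm (g (n - 1)) \<le> vnorm (g j)" using vnorm_T_le[OF g] by simp
    then show "1 \<le> vnorm (g j)" using f(3) by (simp add: g_def)
  qed
  have orth: "ip (g j) (g i) = 0" if ij: "i < j" "j < n" for i j
  proof -
    \<comment> \<open>The map to the last orbit vector preserves the norm of \<open>g i\<close>, so
      its adjoint leads back to \<open>g i\<close>; transferred to the other factor, it sends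
      \<open>g j\<close> to an index of at least \<open>n\<close>.\<close>
    have *: "T (n - 1 - i) *\<^sub>v g i = g (n - 1)" using ij by (simp add: Tg)
    have "adj (T (n - 1 - i)) *\<^sub>v (T (n - 1 - i) *\<^sub>v g i) = g i"
    proof (rule contraction_isometric_vector[OF T_carrier vnorm_T_le g])
      show "vnorm (T (n - 1 - i) *\<^sub>v g i) = vnorm (g i)" unfolding * using ij by (simp add: gn)
    qed
    then have "ip (g j) (g i) = ip (g j) (adj (T (n - 1 - i)) *\<^sub>v g (n - 1))" by (simp only: *)
    also have "\<dots> = ip (g (n - 1 - i + j)) (g (n - 1))" by (simp add: ip_adj[OF T_carrier g g, symmetric] Tg)
    also have "g (n - 1 - i + j) = 0\<^sub>v m" using ij by (intro g0) auto
    finally show ?thesis using g by simp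
  qed
  have gg: "ip (g i) (g j) = (if i = j then 1 else 0)" if ij: "i < n" "j < n" for i j
    using orth[of i j] orth[of j i] ip_cnj[OF g g, of i j] ij gn[of i]
    by (cases i j rule: linorder_cases) (auto simp: ip_self)
  \<comment> \<open>The order is reversed because the Jordan block lowers the index of basis vectors
    while \<open>T 1\<close> raises the index along the orbit.\<close>
  define e where "e j = g (n - 1 - j)" for j
  have e: "orthonormal_family n n e" using g gg mn by (auto simp: orthonormal_family_def e_def)
  have "ip (\<phi> (toep n a) *\<^sub>v e j) (e i) = toep n a $$ (i,j)" if ij: "i < n" "j < n" for a i j
  proof -
    have "ip (\<phi> (toep n a) *\<^sub>v e j) (e i) = (\<Sum>k<n. a k * ip (T k *\<^sub>v e j) (e i))"
      by (rule phi_form) (auto simp: e_def g)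
    also have "\<dots> = (\<Sum>k<n. if k + (n - 1 - j) = n - 1 - i then a k else 0)"
    proof (intro sum.cong refl)
      fix k
      show "a k * ip (T k *\<^sub>v e j) (e i) = (if k + (n - 1 - j) = n - 1 - i then a k else 0)"
        using gg[of "k + (n - 1 - j)" "n - 1 - i"] ij g0[of "k + (n - 1 - j)"] g
        by (cases "k + (n - 1 - j) < n") (auto simp: e_def Tg)
    qed
    also have "\<dots> = (\<Sum>k<n. if k = j - i then (if i \<le> j then a k else 0) else 0)"
      using ij by (intro sum.cong refl) auto
    also have "\<dots> = toep n a $$ (i,j)" using ij by (auto simp: toep_def)
    finally show ?thesis .
  qed
  then show ?thesis using e by blast
qed

end

section \<open>Representations onto a full matrix algebra\<close>

lemma parseval:
  assumes e: "orthonormal_family m m e" and y: "y \<in> carrier_vec m"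
  shows "(\<Sum>k<m. (cmod (ip y (e k)))\<^sup>2) = (vnorm y)\<^sup>2"
proof -
  let ?U = "mat_of_family m m e"
  have ec: "\<And>i. i < m \<Longrightarrow> e i \<in> carrier_vec m" using e by (auto simp: orthonormal_family_def)
  have U: "?U \<in> carrier_mat m m" "adj ?U \<in> carrier_mat m m" by auto
  have Uy: "adj ?U *\<^sub>v y \<in> carrier_vec m" using U y by (auto intro: mult_mat_vec_carrier)
  have "(\<Sum>k<m. (cmod (ip y (e k)))\<^sup>2) = (vnorm (adj ?U *\<^sub>v y))\<^sup>2"
    using Uy by (simp add: vnorm_def sum_nonneg mat_of_family_mult_vec_ip[OF ec y] del: index_mult_mat_vec)
  also have "\<dots> = Re (ip (?U *\<^sub>v (adj ?U *\<^sub>v y)) y)"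
    using ip_adj[OF U(1) Uy y] by (simp add: vnorm_square)
  also have "?U *\<^sub>v (adj ?U *\<^sub>v y) = y"
    using orthonormal_unitary[OF e] assoc_mult_mat_vec[OF U(1) U(2) y] y by (simp add: unitary_mat_def)
  finally show ?thesis by (simp add: vnorm_square)
qed

lemma vnorm_mat_of_family_mult:
  assumes e: "orthonormal_family m k e" and v: "v \<in> carrier_vec k"
  shows "vnorm (mat_of_family m k e *\<^sub>v v) = vnorm v"
proof -
  let ?R = "mat_of_family m k e"
  have R: "?R \<in> carrier_mat m k" "adj ?R \<in> carrier_mat k m" by auto
  have Rv: "?R *\<^sub>v v \<in> carrier_vec m" using R v by (auto intro: mult_mat_vec_carrier)
  have "adj ?R *\<^sub>v (?R *\<^sub>v v) = v"
    using adj_mat_of_family_self[OF e] assoc_mult_mat_vec[OF R(2) R(1) v] v by simp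
  then have "(vnorm (?R *\<^sub>v v))\<^sup>2 = (vnorm v)\<^sup>2"
    using ip_adj[OF R(1) v Rv] by (simp add: vnorm_square)
  then show ?thesis by (simp add: power2_eq_iff_nonneg)
qed

text \<open>With \<open>y\<close> the image of \<open>v\<close> under the compression, the squared
  norm of \<open>y\<close> is the inner product of \<open>A *\<^sub>v (?R *\<^sub>v v)\<close> with
  \<open>?R *\<^sub>v y\<close>. Cauchy-Schwarz and the isometry \<open>?R\<close> bound it, and one
  factor \<open>vnorm y\<close> cancels.\<close>

lemma opnorm_compression_le:
  assumes e: "orthonormal_family m k e" and A: "A \<in> carrier_mat m m"
  shows "opnorm (adj (mat_of_family m k e) * (A * mat_of_family m k e)) \<le> opnorm A"
proof (rule opnorm_le)
  let ?R = "mat_of_family m k e"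
  have R: "?R \<in> carrier_mat m k" "adj ?R \<in> carrier_mat k m" by auto
  have AR: "A * ?R \<in> carrier_mat m k" using A by auto
  show "adj ?R * (A * ?R) \<in> carrier_mat k k" using R AR by auto
  fix v :: "complex vec" assume v: "v \<in> carrier_vec k"
  have Rv: "?R *\<^sub>v v \<in> carrier_vec m" using R v by (auto intro: mult_mat_vec_carrier)
  have ARv: "A *\<^sub>v (?R *\<^sub>v v) \<in> carrier_vec m" using A Rv by (auto intro: mult_mat_vec_carrier)
  define y where "y = adj ?R *\<^sub>v (A *\<^sub>v (?R *\<^sub>v v))"
  have y: "y \<in> carrier_vec k" unfolding y_def using R(2) ARv by (rule mult_mat_vec_carrier)
  have Ry: "?R *\<^sub>v y \<in> carrier_vec m" using R y by (auto intro: mult_mat_vec_carrier)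
  have eq: "(adj ?R * (A * ?R)) *\<^sub>v v = y"
    unfolding y_def assoc_mult_mat_vec[OF R(2) AR v] assoc_mult_mat_vec[OF A R(1) v] ..
  have "ip y y = ip (A *\<^sub>v (?R *\<^sub>v v)) (?R *\<^sub>v y)"
    using ip_adj[OF R(2) ARv y] by (simp add: y_def)
  then have "(vnorm y)\<^sup>2 \<le> cmod (ip (A *\<^sub>v (?R *\<^sub>v v)) (?R *\<^sub>v y))"
    by (metis vnorm_square complex_Re_le_cmod)
  also have "\<dots> \<le> vnorm (A *\<^sub>v (?R *\<^sub>v v)) * vnorm (?R *\<^sub>v y)" by (rule cauchy_schwarz[OF ARv Ry])
  also have "\<dots> \<le> (opnorm A * vnorm (?R *\<^sub>v v)) * vnorm (?R *\<^sub>v y)"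
    by (intro mult_right_mono vnorm_mult_le_opnorm[OF A Rv]) simp
  finally have *: "vnorm y * vnorm y \<le> (opnorm A * vnorm v) * vnorm y"
    by (simp only: vnorm_mat_of_family_mult[OF e v] vnorm_mat_of_family_mult[OF e y] power2_eq_square)
  have "vnorm y \<le> opnorm A * vnorm v"
  proof (cases "vnorm y = 0")
    case True
    then show ?thesis using opnorm_nonneg[OF A] by simp
  next
    case False
    then have "0 < vnorm y" using vnorm_nonneg[of y] by linarith
    then show ?thesis using * by (simp only: mult_le_cancel_right_pos)
  qed
  then show "vnorm ((adj ?R * (A * ?R)) *\<^sub>v v) \<le> opnorm A * vnorm v" by (simp only: eq)
qed (rule opnorm_nonneg[OF A])

lemma nonzero_mat_mult_vec:
  assumes A: "(A :: complex mat) \<in> carrier_mat r m" and A0: "A \<noteq> 0\<^sub>m r m"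
  shows "\<exists>v\<in>carrier_vec m. A *\<^sub>v v \<noteq> 0\<^sub>v r"
proof (rule ccontr)
  assume "\<not> ?thesis"
  then have all: "A *\<^sub>v v = 0\<^sub>v r" if "v \<in> carrier_vec m" for v using that by blast
  have "A = 0\<^sub>m r m"
  proof (rule eq_matI)
    fix i j assume "i < dim_row (0\<^sub>m r m :: complex mat)" "j < dim_col (0\<^sub>m r m :: complex mat)"
    then have ij: "i < r" "j < m" by auto
    have "(A *\<^sub>v unit_vec m j) $ i = (\<Sum>l<m. if l = j then A $$ (i,l) else 0)"
      unfolding mult_mat_vec_index[OF A unit_vec_carrier ij(1)] by (intro sum.cong) (auto simp: unit_vec_def)
    also have "\<dots> = A $$ (i,j)" using ij by simp
    finally show "A $$ (i,j) = 0\<^sub>m r m $$ (i,j)" using all[of "unit_vec m j"] ij by simp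
  qed (use A in auto)
  then show False using A0 by simp
qed

text \<open>A unit vector at which \<open>C\<close> attains its norm \<open>s\<close> works, with
  eigenvalue \<open>s * s\<close>: after division by \<open>s\<close> the matrix is a contraction
  that is isometric at \<open>u\<close>.\<close>

lemma gram_nonzero_eigenvalue:
  assumes C: "C \<in> carrier_mat m m" and C0: "C \<noteq> 0\<^sub>m m m"
  shows "\<exists>c u. c \<noteq> 0 \<and> u \<in> carrier_vec m \<and> u \<noteq> 0\<^sub>v m \<and> adj C *\<^sub>v (C *\<^sub>v u) = c \<cdot>\<^sub>v u"
proof -
  have m: "0 < m"
  proof (rule ccontr)
    assume "\<not> 0 < m"
    then have "C = 0\<^sub>m m m" using C by (intro eq_matI) auto
    then show False using C0 by simp
  qed
  have G: "adj C * C \<in> carrier_mat m m" using C by auto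
  have form: "Re (ip (adj C * C *\<^sub>v v) v) = (vnorm (C *\<^sub>v v))\<^sup>2" if v: "v \<in> carrier_vec m" for v
    using ip_adj[of "adj C" m m "C *\<^sub>v v" v] v C assoc_mult_mat_vec[OF adj_carrier[OF C] C v]
    by (simp add: vnorm_square)
  obtain u where u: "u \<in> carrier_vec m" "vnorm u = 1"
    and max: "\<And>v. v \<in> carrier_vec m \<Longrightarrow> Re (ip (adj C * C *\<^sub>v v) v) \<le> Re (ip (adj C * C *\<^sub>v u) u) * (vnorm v)\<^sup>2"
    using quadratic_form_attains_max[OF G m] by blast
  define s where "s = vnorm (C *\<^sub>v u)"
  have le: "vnorm (C *\<^sub>v v) \<le> s * vnorm v" if v: "v \<in> carrier_vec m" for v
  proof -
    have "(vnorm (C *\<^sub>v v))\<^sup>2 \<le> (s * vnorm v)\<^sup>2"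
      using max[OF v] form[OF v] form[OF u(1)] by (simp add: power_mult_distrib s_def)
    then show ?thesis by (rule power2_le_imp_le) (simp add: s_def)
  qed
  obtain v where v: "v \<in> carrier_vec m" "C *\<^sub>v v \<noteq> 0\<^sub>v m" using nonzero_mat_mult_vec[OF C C0] by blast
  have Cv: "C *\<^sub>v v \<in> carrier_vec m" "C *\<^sub>v u \<in> carrier_vec m" using C v u by auto
  have s0: "s \<noteq> 0"
  proof
    assume "s = 0"
    then have "vnorm (C *\<^sub>v v) = 0" using le[OF v(1)] vnorm_nonneg[of "C *\<^sub>v v"] by simp
    then show False using vnorm_eq_0_iff[OF Cv(1)] v(2) by simp
  qed
  then have s: "0 < s" by (simp add: s_def less_le)
  define A where "A = complex_of_real (1 / s) \<cdot>\<^sub>m C"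
  have A: "A \<in> carrier_mat m m" using C by (simp add: A_def)
  have Av: "A *\<^sub>v v = complex_of_real (1 / s) \<cdot>\<^sub>v (C *\<^sub>v v)" if "v \<in> carrier_vec m" for v
    unfolding A_def by (rule smult_mat_mult_mat_vec[OF C that])
  have nA: "vnorm (A *\<^sub>v v) = vnorm (C *\<^sub>v v) / s" if "v \<in> carrier_vec m" for v
    unfolding Av[OF that] vnorm_smult using s by (simp add: norm_divide)
  have "adj A *\<^sub>v (A *\<^sub>v u) = u"
  proof (rule contraction_isometric_vector[OF A _ u(1)])
    show "vnorm (A *\<^sub>v v) \<le> vnorm v" if "v \<in> carrier_vec m" for v
      using le[OF that] s by (simp add: nA[OF that] field_simps)
    show "vnorm (A *\<^sub>v u) = vnorm u" using s u by (simp add: nA s_def[symmetric])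
  qed
  moreover have "adj A = complex_of_real (1 / s) \<cdot>\<^sub>m adj C"
    by (rule eq_matI) (auto simp: A_def)
  ultimately have eq: "complex_of_real (1 / s) \<cdot>\<^sub>v (adj C *\<^sub>v (complex_of_real (1 / s) \<cdot>\<^sub>v (C *\<^sub>v u))) = u"
    using smult_mat_mult_mat_vec[OF adj_carrier[OF C], of "A *\<^sub>v u"] Av[OF u(1)] A u(1) Cv by simp
  have "adj C *\<^sub>v (complex_of_real (1 / s) \<cdot>\<^sub>v (C *\<^sub>v u)) = complex_of_real (1 / s) \<cdot>\<^sub>v (adj C *\<^sub>v (C *\<^sub>v u))"
    by (rule mult_mat_vec[OF adj_carrier[OF C] Cv(2)])
  with eq have eq': "complex_of_real (1 / s) \<cdot>\<^sub>v (complex_of_real (1 / s) \<cdot>\<^sub>v (adj C *\<^sub>v (C *\<^sub>v u))) = u" by simp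
  have "adj C *\<^sub>v (C *\<^sub>v u) = complex_of_real (s * s) \<cdot>\<^sub>v u"
    by (subst eq'[symmetric]) (use s0 in \<open>simp add: smult_smult_assoc\<close>)
  moreover have "u \<noteq> 0\<^sub>v m" using u by auto
  ultimately show ?thesis using s0 u(1) by (intro exI[of _ "complex_of_real (s * s)"] exI[of _ u]) simp
qed

locale cstar_onto =
  fixes S :: "complex mat set" and m n :: nat and \<pi> :: "complex mat \<Rightarrow> complex mat"
  assumes S_carrier: "S \<subseteq> carrier_mat m m"
    and hom: "star_hom_onto (cstar_gen m S) m n \<pi>"
    and n_pos: "0 < n"
begin

abbreviation "B \<equiv> cstar_gen m S"

lemma B_carrier: "X \<in> B \<Longrightarrow> X \<in> carrier_mat m m"
  by (induction rule: cstar_gen.induct) (use S_carrier in auto)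

lemma pi_carrier: "X \<in> B \<Longrightarrow> \<pi> X \<in> carrier_mat n n"
  using hom by (auto simp: star_hom_onto_def)

lemma pi_one: "\<pi> (1\<^sub>m m) = 1\<^sub>m n"
  using hom by (simp add: star_hom_onto_def)

lemma pi_add: "X \<in> B \<Longrightarrow> Y \<in> B \<Longrightarrow> \<pi> (X + Y) = \<pi> X + \<pi> Y"
  using hom by (simp add: star_hom_onto_def)

lemma pi_smult: "X \<in> B \<Longrightarrow> \<pi> (c \<cdot>\<^sub>m X) = c \<cdot>\<^sub>m \<pi> X"
  using hom by (simp add: star_hom_onto_def)

lemma pi_mult: "X \<in> B \<Longrightarrow> Y \<in> B \<Longrightarrow> \<pi> (X * Y) = \<pi> X * \<pi> Y"
  using hom by (simp add: star_hom_onto_def)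

lemma pi_adj: "X \<in> B \<Longrightarrow> \<pi> (adj X) = adj (\<pi> X)"
  using hom by (simp add: star_hom_onto_def)

lemma pi_surj: "M \<in> carrier_mat n n \<Longrightarrow> \<exists>X\<in>B. \<pi> X = M"
  using hom unfolding star_hom_onto_def by (metis imageE)

lemmas B_intros = cstar_gen.one cstar_gen.add cstar_gen.smult cstar_gen.mult cstar_gen.adjoint

text \<open>With \<open>G = (b x)\<^sup>* (b x)\<close> and \<open>G u = c u\<close>, \<open>c \<noteq> 0\<close>, the element \<open>x - c\<^sup>-\<^sup>1 x G\<close> has the same image as \<open>x\<close>
  and additionally annihilates \<open>u\<close>.\<close>
lemma kernel_increase:
  assumes x: "x \<in> B" "\<pi> x \<noteq> 0\<^sub>m n n" and e: "orthonormal_family m k e" and xe: "\<And>i. i < k \<Longrightarrow> x *\<^sub>v e i = 0\<^sub>v m"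
    and b: "b \<in> B" "\<pi> b = 0\<^sub>m n n" and bx: "b * x \<noteq> 0\<^sub>m m m"
  shows "\<exists>x'\<in>B. \<pi> x' \<noteq> 0\<^sub>m n n \<and> (\<exists>e'. orthonormal_family m (Suc k) e' \<and> (\<forall>i<Suc k. x' *\<^sub>v e' i = 0\<^sub>v m))"
proof -
  define C where "C = b * x"
  have C: "C \<in> B" "C \<in> carrier_mat m m" using b x B_intros B_carrier by (auto simp: C_def)
  have aC: "adj C \<in> B" "adj C \<in> carrier_mat m m" using C B_intros by auto
  have xc: "x \<in> carrier_mat m m" and bc: "b \<in> carrier_mat m m" using x b B_carrier by auto
  obtain c u where c: "c \<noteq> 0" and u: "u \<in> carrier_vec m" "u \<noteq> 0\<^sub>v m" and ev: "adj C *\<^sub>v (C *\<^sub>v u) = c \<cdot>\<^sub>v u"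
    using gram_nonzero_eigenvalue[OF C(2)] bx by (auto simp: C_def)
  define x' where "x' = x + (- 1 / c) \<cdot>\<^sub>m (x * (adj C * C))"
  have G: "adj C * C \<in> B" "x * (adj C * C) \<in> B" using C aC x B_intros by auto
  have x': "x' \<in> B" unfolding x'_def using x G B_intros by auto
  have x'c: "x' \<in> carrier_mat m m" using x' B_carrier by auto
  have "\<pi> C = 0\<^sub>m n n" using b x pi_carrier by (simp add: C_def pi_mult left_mult_zero_mat[of _ n n])
  then have "\<pi> (x * (adj C * C)) = 0\<^sub>m n n"
    using G C aC x pi_carrier[OF aC(1)] pi_carrier[OF x(1)]
    by (simp add: pi_mult right_mult_zero_mat[of _ n n])
  then have "\<pi> x' = \<pi> x"
    using x G pi_carrier[OF x(1)] by (simp add: x'_def pi_add pi_smult B_intros)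
  have x'v: "x' *\<^sub>v v = x *\<^sub>v v + (- 1 / c) \<cdot>\<^sub>v (x *\<^sub>v (adj C *\<^sub>v (C *\<^sub>v v)))" if v: "v \<in> carrier_vec m" for v
  proof -
    have "x' *\<^sub>v v = x *\<^sub>v v + (- 1 / c) \<cdot>\<^sub>v ((x * (adj C * C)) *\<^sub>v v)"
      unfolding x'_def using v B_carrier[OF G(2)] xc
      by (subst add_mult_distrib_mat_vec[of _ m m]) (auto simp only: smult_mat_mult_mat_vec smult_carrier_mat)
    also have "(x * (adj C * C)) *\<^sub>v v = x *\<^sub>v (adj C *\<^sub>v (C *\<^sub>v v))"
      using assoc_mult_mat_vec[OF xc B_carrier[OF G(1)] v] assoc_mult_mat_vec[OF aC(2) C(2) v] by simp
    finally show ?thesis .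
  qed
  have Cv: "C *\<^sub>v v = 0\<^sub>v m" if "v \<in> carrier_vec m" "x *\<^sub>v v = 0\<^sub>v m" for v
    unfolding C_def using assoc_mult_mat_vec[OF bc xc that(1)] that(2) bc by auto
  have z: "A *\<^sub>v 0\<^sub>v m = 0\<^sub>v m" if "A \<in> carrier_mat m m" for A :: "complex mat"
    using that by auto
  have x'0: "x' *\<^sub>v v = 0\<^sub>v m" if "v \<in> carrier_vec m" "x *\<^sub>v v = 0\<^sub>v m" for v
    unfolding x'v[OF that(1)] Cv[OF that] that(2) z[OF aC(2)] z[OF xc] by (intro eq_vecI) auto
  have x'u: "x' *\<^sub>v u = 0\<^sub>v m"
    unfolding x'v[OF u(1)] ev mult_mat_vec[OF xc u(1)] using c xc u(1) by (intro eq_vecI) auto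
  have xu: "x *\<^sub>v u \<noteq> 0\<^sub>v m"
  proof
    assume "x *\<^sub>v u = 0\<^sub>v m"
    then have "c \<cdot>\<^sub>v u = 0\<^sub>v m" using Cv[OF u(1)] ev z[OF aC(2)] by simp
    then have "c * u $ i = 0" if "i < m" for i
      using that u(1) by (metis carrier_vecD index_smult_vec(1) index_zero_vec(1))
    then have "u = 0\<^sub>v m" using c u(1) by (intro eq_vecI) auto
    then show False using u(2) by simp
  qed
  have ec: "\<And>i. i < k \<Longrightarrow> e i \<in> carrier_vec m" using e by (auto simp: orthonormal_family_def)
  let ?E = "mat_of_family m k e"
  have E: "?E \<in> carrier_mat m k" "adj ?E \<in> carrier_mat k m" by auto
  \<comment> \<open>\<open>x\<close> vanishes on the span of the \<open>e i\<close> but not at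
    \<open>u\<close>, so \<open>u\<close> really enlarges the family.\<close>
  have ne: "u \<noteq> ?E *\<^sub>v (adj ?E *\<^sub>v u)"
  proof
    assume eq: "u = ?E *\<^sub>v (adj ?E *\<^sub>v u)"
    have y: "adj ?E *\<^sub>v u \<in> carrier_vec k" using E u by (auto intro: mult_mat_vec_carrier)
    have "x *\<^sub>v u = (x * ?E) *\<^sub>v (adj ?E *\<^sub>v u)"
      by (subst eq) (rule assoc_mult_mat_vec[OF xc E(1) y, symmetric])
    also have "x * ?E = 0\<^sub>m m k" by (rule mult_mat_of_family_zero[OF ec xc xe])
    also have "0\<^sub>m m k *\<^sub>v (adj ?E *\<^sub>v u) = 0\<^sub>v m" using y by (intro eq_vecI) auto
    finally show False using xu by simp
  qed
  obtain w where w: "orthonormal_family m (Suc k) (e(k := w))"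
    and Aw: "\<And>A r. A \<in> carrier_mat r m \<Longrightarrow> A *\<^sub>v u = 0\<^sub>v r \<Longrightarrow> (\<And>i. i < k \<Longrightarrow> A *\<^sub>v e i = 0\<^sub>v r) \<Longrightarrow> A *\<^sub>v w = 0\<^sub>v r"
    using orthonormal_extend[OF e u(1) ne] by blast
  have "x' *\<^sub>v w = 0\<^sub>v m" using Aw[OF x'c x'u] x'0 ec xe by blast
  then have "\<forall>i<Suc k. x' *\<^sub>v (e(k := w)) i = 0\<^sub>v m" using x'0 ec xe by (auto simp: less_Suc_eq)
  then show ?thesis using x' \<open>\<pi> x' = \<pi> x\<close> x(2) w by metis
qed

text \<open>By \<open>kernel_increase\<close>, an element outside the kernel of \<open>\<pi>\<close> that is not annihilated could be replaced
  by ones with ever larger null spaces.\<close>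
lemma exists_annihilated:
  "\<exists>x\<in>B. \<pi> x \<noteq> 0\<^sub>m n n \<and> (\<forall>b\<in>B. \<pi> b = 0\<^sub>m n n \<longrightarrow> b * x = 0\<^sub>m m m)"
proof (rule ccontr)
  assume neg: "\<not> ?thesis"
  have "\<exists>x\<in>B. \<pi> x \<noteq> 0\<^sub>m n n \<and> (\<exists>e. orthonormal_family m k e \<and> (\<forall>i<k. x *\<^sub>v e i = 0\<^sub>v m))" for k
  proof (induction k)
    case 0
    have "(1\<^sub>m n :: complex mat) $$ (0,0) \<noteq> 0\<^sub>m n n $$ (0,0)" using n_pos by simp
    then have "\<pi> (1\<^sub>m m) \<noteq> 0\<^sub>m n n" unfolding pi_one by metis
    then show ?case using cstar_gen.one by (intro bexI[of _ "1\<^sub>m m"]) (auto simp: orthonormal_family_def)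
  next
    case (Suc k)
    then obtain x e where x: "x \<in> B" "\<pi> x \<noteq> 0\<^sub>m n n" and e: "orthonormal_family m k e" "\<And>i. i < k \<Longrightarrow> x *\<^sub>v e i = 0\<^sub>v m"
      by blast
    obtain b where "b \<in> B" "\<pi> b = 0\<^sub>m n n" "b * x \<noteq> 0\<^sub>m m m" using neg x by blast
    then show ?case using kernel_increase[OF x e] by blast
  qed
  \<comment> \<open>Dimension \<open>m\<close> has no room for \<open>m + 1\<close> orthonormal
    vectors in a null space.\<close>
  from this[of "Suc m"] show False using orthonormal_card_le by fastforce
qed

section \<open>Vector states and reducing copies from lifted matrix units\<close>

definition munit :: "nat \<Rightarrow> complex mat" where
  "munit i = mat n n (\<lambda>(r,s). if r = 0 \<and> s = i then 1 else 0)"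

lemma munit_carrier[simp, intro]: "munit i \<in> carrier_mat n n"
  by (simp add: munit_def)

lemma munit_mult_index:
  assumes "A \<in> carrier_mat n n" "i < n" "r < n" "s < n"
  shows "(munit i * A) $$ (r,s) = (if r = 0 then A $$ (i,s) else 0)"
proof -
  have "(munit i * A) $$ (r,s) = (\<Sum>l<n. if l = i then (if r = 0 then A $$ (i,s) else 0) else 0)"
    unfolding mult_mat_index[OF munit_carrier assms(1,3,4)] using assms
    by (intro sum.cong) (auto simp: munit_def)
  then show ?thesis using assms by simp
qed

text \<open>Take \<open>x\<close> annihilated by the kernel of \<open>\<pi>\<close> and a lift
  \<open>c\<close> of a matrix unit with \<open>\<pi> (c * x)\<close> nonzero. A unit vector
  \<open>w\<close> in the range of \<open>c * x\<close> is killed by the kernel, so identities in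
  the full matrix algebra hold for lifts at \<open>w\<close>. With \<open>p\<close> a lift of the
  corner projection, \<open>p d p - a p\<close> lies in the kernel for
  \<open>a = \<pi> d $$ (0,0)\<close>, which evaluates the form.\<close>

lemma exists_vector_state:
  "\<exists>w\<in>carrier_vec m. \<forall>d\<in>B. ip (d *\<^sub>v w) w = \<pi> d $$ (0,0)"
proof -
  obtain x where x: "x \<in> B" "\<pi> x \<noteq> 0\<^sub>m n n" and ann: "\<And>b. b \<in> B \<Longrightarrow> \<pi> b = 0\<^sub>m n n \<Longrightarrow> b * x = 0\<^sub>m m m"
    using exists_annihilated by blast
  have xc: "x \<in> carrier_mat m m" using x B_carrier by auto
  obtain i j where ij: "i < n" "j < n" "\<pi> x $$ (i,j) \<noteq> 0"
  proof -
    have "\<exists>i j. i < n \<and> j < n \<and> \<pi> x $$ (i,j) \<noteq> 0"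
    proof (rule ccontr)
      assume "\<not> ?thesis"
      then have "\<pi> x = 0\<^sub>m n n" using pi_carrier[OF x(1)] by (intro eq_matI) auto
      then show False using x by simp
    qed
    then show ?thesis using that by blast
  qed
  obtain c p where c: "c \<in> B" "\<pi> c = munit i" and p: "p \<in> B" "\<pi> p = munit 0" using pi_surj by (meson munit_carrier)
  have cc: "c \<in> carrier_mat m m" and pc: "p \<in> carrier_mat m m" using c p B_carrier by auto
  define z where "z = c * x"
  have z: "z \<in> B" "z \<in> carrier_mat m m" using c x B_intros B_carrier by (auto simp: z_def)
  have "z \<noteq> 0\<^sub>m m m"
  proof
    assume "z = 0\<^sub>m m m"
    then have "z = 0 \<cdot>\<^sub>m z" by (intro eq_matI) auto
    then have "\<pi> z = 0 \<cdot>\<^sub>m \<pi> z" using pi_smult[OF z(1)] by metis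
    then have "\<pi> z $$ (0,j) = 0" using pi_carrier[OF z(1)] ij(2) n_pos by (metis carrier_matD index_smult_mat(1) mult_zero_left)
    moreover have "\<pi> z $$ (0,j) = \<pi> x $$ (i,j)"
      using munit_mult_index[OF pi_carrier[OF x(1)] ij(1) n_pos ij(2)] c x by (simp add: z_def pi_mult)
    ultimately show False using ij(3) by simp
  qed
  then obtain v where v: "v \<in> carrier_vec m" "z *\<^sub>v v \<noteq> 0\<^sub>v m" using nonzero_mat_mult_vec[OF z(2)] by blast
  define y where "y = z *\<^sub>v v"
  have y: "y \<in> carrier_vec m" "y \<noteq> 0\<^sub>v m" using v z by (auto simp: y_def)
  define w where "w = complex_of_real (1 / vnorm y) \<cdot>\<^sub>v y"
  have w: "w \<in> carrier_vec m" using y by (simp add: w_def)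
  have ww: "ip w w = 1" using vnorm_normalize[OF y] by (simp add: ip_self w_def)
  have zero_vec: "0\<^sub>m m m *\<^sub>v q = 0\<^sub>v m" if "q \<in> carrier_vec m" for q :: "complex vec"
    using that by (intro eq_vecI) auto
  have smult0: "a \<cdot>\<^sub>v 0\<^sub>v m = 0\<^sub>v m" for a :: complex by (intro eq_vecI) auto
  have kerw: "b *\<^sub>v w = 0\<^sub>v m" if b: "b \<in> B" "b * z = 0\<^sub>m m m" for b
  proof -
    have "b *\<^sub>v y = (b * z) *\<^sub>v v" unfolding y_def by (rule assoc_mult_mat_vec[OF B_carrier[OF b(1)] z(2) v(1), symmetric])
    also have "\<dots> = 0\<^sub>v m" unfolding b(2) by (rule zero_vec[OF v(1)])
    finally show ?thesis unfolding w_def mult_mat_vec[OF B_carrier[OF b(1)] y(1)] by (simp only: smult0)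
  qed
  \<comment> \<open>The product \<open>b * c\<close> is still in the kernel, hence annihilates
    \<open>x\<close>.\<close>
  have ker: "b *\<^sub>v w = 0\<^sub>v m" if b: "b \<in> B" "\<pi> b = 0\<^sub>m n n" for b
  proof (rule kerw[OF b(1)])
    have "\<pi> (b * c) = 0\<^sub>m n n" using b c pi_mult pi_carrier[OF c(1)] by (simp add: left_mult_zero_mat[of _ n n])
    then have "(b * c) * x = 0\<^sub>m m m" using ann[OF cstar_gen.mult[OF b(1) c(1)]] by blast
    then show "b * z = 0\<^sub>m m m" unfolding z_def using assoc_mult_mat[OF B_carrier[OF b(1)] cc xc] by simp
  qed
  have sub0: "q = q'" if "q + (-a) \<cdot>\<^sub>v r = 0\<^sub>v m" "q' = a \<cdot>\<^sub>v r" "q \<in> carrier_vec m" "r \<in> carrier_vec m" for q q' r :: "complex vec" and a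
  proof (rule eq_vecI)
    fix k assume "k < dim_vec q'"
    then have k: "k < m" using that by simp
    have "(q + (-a) \<cdot>\<^sub>v r) $ k = 0" using that(1) k by simp
    then show "q $ k = q' $ k" using that(2-4) k by simp
  qed (use that in auto)
  have affine: "(X + (-a) \<cdot>\<^sub>m Y) *\<^sub>v q = X *\<^sub>v q + (-a) \<cdot>\<^sub>v (Y *\<^sub>v q)"
    if "X \<in> carrier_mat m m" "Y \<in> carrier_mat m m" "q \<in> carrier_vec m" for X Y :: "complex mat" and q a
    using that by (subst add_mult_distrib_mat_vec[of _ m m]) (auto simp only: smult_mat_mult_mat_vec smult_carrier_mat)
  \<comment> \<open>This element has image 0, so it annihilates \<open>x\<close>; hence
    \<open>p\<close> fixes \<open>y\<close> and therefore \<open>w\<close>.\<close>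
  have pz: "p * c + (-1) \<cdot>\<^sub>m c \<in> B" using p c B_intros by auto
  have "\<pi> (p * c + (-1) \<cdot>\<^sub>m c) = munit 0 * munit i + (-1) \<cdot>\<^sub>m munit i"
    using p c B_intros by (simp add: pi_add pi_smult pi_mult)
  also have "munit 0 * munit i = munit i"
  proof (rule eq_matI)
    fix r s assume "r < dim_row (munit i)" "s < dim_col (munit i)"
    then have rs: "r < n" "s < n" by (auto simp: munit_def)
    show "(munit 0 * munit i) $$ (r,s) = munit i $$ (r,s)"
      unfolding munit_mult_index[OF munit_carrier n_pos rs] using rs by (simp add: munit_def)
  qed (auto simp: munit_def)
  also have "munit i + (-1) \<cdot>\<^sub>m munit i = 0\<^sub>m n n" by (rule eq_matI) (auto simp: munit_def)
  finally have "(p * c + (-1) \<cdot>\<^sub>m c) * x = 0\<^sub>m m m" using ann[OF pz] by simp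
  then have "((p * c + (-1) \<cdot>\<^sub>m c) * x) *\<^sub>v v = 0\<^sub>v m" using zero_vec[OF v(1)] by simp
  moreover have "((p * c + (-1) \<cdot>\<^sub>m c) * x) *\<^sub>v v = p *\<^sub>v y + (-1) \<cdot>\<^sub>v y"
  proof -
    have xv: "x *\<^sub>v v \<in> carrier_vec m" using xc v by auto
    have yc: "y = c *\<^sub>v (x *\<^sub>v v)" unfolding y_def z_def by (rule assoc_mult_mat_vec[OF cc xc v(1)])
    have "((p * c + (-1) \<cdot>\<^sub>m c) * x) *\<^sub>v v = (p * c + (-1) \<cdot>\<^sub>m c) *\<^sub>v (x *\<^sub>v v)"
      by (rule assoc_mult_mat_vec[OF B_carrier[OF pz] xc v(1)])
    also have "\<dots> = (p * c) *\<^sub>v (x *\<^sub>v v) + (-1) \<cdot>\<^sub>v (c *\<^sub>v (x *\<^sub>v v))"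
      by (rule affine) (use pc cc xv in auto)
    also have "(p * c) *\<^sub>v (x *\<^sub>v v) = p *\<^sub>v (c *\<^sub>v (x *\<^sub>v v))"
      by (rule assoc_mult_mat_vec[OF pc cc xv])
    finally show ?thesis by (simp only: yc)
  qed
  ultimately have "p *\<^sub>v y + (-1) \<cdot>\<^sub>v y = 0\<^sub>v m" by simp
  then have py: "p *\<^sub>v y = y" by (rule sub0) (use pc y in auto)
  have pw: "p *\<^sub>v w = w" unfolding w_def mult_mat_vec[OF pc y(1)] py ..
  have "ip (d *\<^sub>v w) w = \<pi> d $$ (0,0)" if d: "d \<in> B" for d
  proof -
    have dc: "d \<in> carrier_mat m m" using d B_carrier by auto
    define a where "a = \<pi> d $$ (0,0)"
    define X where "X = p * (d * p) + (-a) \<cdot>\<^sub>m p"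
    have X: "X \<in> B" unfolding X_def using p d B_intros by auto
    have "\<pi> X = munit 0 * (\<pi> d * munit 0) + (-a) \<cdot>\<^sub>m munit 0"
      unfolding X_def using p d B_intros by (simp add: pi_add pi_smult pi_mult)
    also have "\<dots> = 0\<^sub>m n n"
    proof (rule eq_matI)
      fix r s assume "r < dim_row (0\<^sub>m n n :: complex mat)" "s < dim_col (0\<^sub>m n n :: complex mat)"
      then have rs: "r < n" "s < n" by auto
      have dm: "\<pi> d * munit 0 \<in> carrier_mat n n" using pi_carrier[OF d] by auto
      have "(\<pi> d * munit 0) $$ (0,s) = (\<Sum>l<n. if l = 0 then (if s = 0 then a else 0) else 0)"
        unfolding mult_mat_index[OF pi_carrier[OF d] munit_carrier n_pos rs(2)]
        using rs by (intro sum.cong) (auto simp: munit_def a_def)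
      also have "\<dots> = (if s = 0 then a else 0)" using n_pos by simp
      finally have "(\<pi> d * munit 0) $$ (0,s) = (if s = 0 then a else 0)" .
      then show "(munit 0 * (\<pi> d * munit 0) + (-a) \<cdot>\<^sub>m munit 0) $$ (r,s) = 0\<^sub>m n n $$ (r,s)"
        using rs munit_mult_index[OF dm n_pos rs] by (auto simp: munit_def simp del: index_mult_mat(1))
    qed (auto simp: munit_def)
    finally have "X *\<^sub>v w = 0\<^sub>v m" using ker[OF X] by simp
    moreover have "X *\<^sub>v w = (p * (d * p)) *\<^sub>v w + (-a) \<cdot>\<^sub>v (p *\<^sub>v w)"
      unfolding X_def by (rule affine) (use pc dc w in auto)
    moreover have "(p * (d * p)) *\<^sub>v w = p *\<^sub>v (d *\<^sub>v w)"
      using assoc_mult_mat_vec[OF pc mult_carrier_mat[OF dc pc] w] assoc_mult_mat_vec[OF dc pc w] pw by simp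
    ultimately have "p *\<^sub>v (d *\<^sub>v w) + (-a) \<cdot>\<^sub>v w = 0\<^sub>v m" using pw by simp
    then have pdw: "p *\<^sub>v (d *\<^sub>v w) = a \<cdot>\<^sub>v w"
      by (rule sub0) (use pc dc w in \<open>auto intro!: mult_mat_vec_carrier\<close>)
    \<comment> \<open>The corner projection is self-adjoint, so \<open>adj p\<close> and
      \<open>p\<close> differ by an element of the kernel, which kills \<open>w\<close>.\<close>
    have apw: "adj p *\<^sub>v w = w"
    proof -
      let ?X = "adj p + (-1) \<cdot>\<^sub>m p"
      have "adj (munit 0) = munit 0" by (rule eq_matI) (auto simp: munit_def)
      then have "\<pi> ?X = munit 0 + (-1) \<cdot>\<^sub>m munit 0"
        using p B_intros by (simp add: pi_add pi_smult pi_adj)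
      also have "\<dots> = 0\<^sub>m n n" by (rule eq_matI) (auto simp: munit_def)
      finally have "?X *\<^sub>v w = 0\<^sub>v m" using p B_intros by (intro ker) auto
      moreover have "?X *\<^sub>v w = adj p *\<^sub>v w + (-1) \<cdot>\<^sub>v (p *\<^sub>v w)"
        by (rule affine) (use pc w in auto)
      ultimately have "adj p *\<^sub>v w + (-1) \<cdot>\<^sub>v w = 0\<^sub>v m" using pw by simp
      then show ?thesis by (rule sub0) (use pc w in \<open>auto intro!: mult_mat_vec_carrier\<close>)
    qed
    have dw: "d *\<^sub>v w \<in> carrier_vec m" using dc w by auto
    have "ip (d *\<^sub>v w) w = ip (p *\<^sub>v (d *\<^sub>v w)) w"
      using ip_adj[OF pc dw w] apw by simp
    also have "\<dots> = a" unfolding pdw using w ww by (simp add: ip_smult_left[of _ m])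
    finally show ?thesis by (simp add: a_def)
  qed
  then show ?thesis using w by blast
qed

text \<open>A GNS-type construction: with \<open>b j\<close> a lift of a matrix sending the first
  basis vector to \<open>f j\<close>, put \<open>e j = b j *\<^sub>v w\<close>. The vector state
  evaluates \<open>adj (b i) * (c * b j)\<close> to the corner entry of its image, which is the
  desired inner product; \<open>c = 1\<close> gives orthonormality.\<close>

lemma exists_copy:
  assumes f: "orthonormal_family n n f"
  shows "\<exists>e. orthonormal_family m n e \<and> (\<forall>c\<in>B. \<forall>i<n. \<forall>j<n. ip (c *\<^sub>v e j) (e i) = ip (\<pi> c *\<^sub>v f j) (f i))"
proof -
  obtain w where w: "w \<in> carrier_vec m" and st: "\<And>d. d \<in> B \<Longrightarrow> ip (d *\<^sub>v w) w = \<pi> d $$ (0,0)"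
    using exists_vector_state by blast
  have fc: "f i \<in> carrier_vec n" if "i < n" for i using f that by (auto simp: orthonormal_family_def)
  \<comment> \<open>Column 0 holds \<open>f j\<close> and all other columns vanish.\<close>
  define F where "F j = mat n n (\<lambda>(r,s). if s = 0 then f j $ r else 0)" for j
  have F: "F j \<in> carrier_mat n n" for j by (simp add: F_def)
  define b where "b j = (SOME X. X \<in> B \<and> \<pi> X = F j)" for j
  have b: "b j \<in> B \<and> \<pi> (b j) = F j" for j
    unfolding b_def by (rule someI_ex) (use pi_surj[OF F] in blast)
  have bc: "b j \<in> carrier_mat m m" for j using b B_carrier by blast
  define e where "e j = b j *\<^sub>v w" for j
  have e: "e j \<in> carrier_vec m" for j unfolding e_def by (rule mult_mat_vec_carrier[OF bc w])
  have form: "ip (c *\<^sub>v e j) (e i) = ip (\<pi> c *\<^sub>v f j) (f i)" if c: "c \<in> B" and ij: "i < n" "j < n" for c i j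
  proof -
    have cc: "c \<in> carrier_mat m m" and pc: "\<pi> c \<in> carrier_mat n n" using c B_carrier pi_carrier by auto
    have X: "c * b j \<in> B" "adj (b i) * (c * b j) \<in> B" "adj (b i) \<in> B" using c b B_intros by auto
    have ce: "c *\<^sub>v e j \<in> carrier_vec m" using cc e by (auto intro: mult_mat_vec_carrier)
    have "(adj (b i) * (c * b j)) *\<^sub>v w = adj (b i) *\<^sub>v (c *\<^sub>v e j)"
      unfolding e_def using assoc_mult_mat_vec[OF B_carrier[OF X(3)] B_carrier[OF X(1)] w] assoc_mult_mat_vec[OF cc bc w] by simp
    then have "ip (c *\<^sub>v e j) (e i) = ip ((adj (b i) * (c * b j)) *\<^sub>v w) w"
      using ip_adj[OF adj_carrier[OF bc] ce w, of i] by (simp add: e_def)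
    also have "\<dots> = (adj (F i) * (\<pi> c * F j)) $$ (0,0)"
      using st[OF X(2)] b c X by (simp add: pi_mult pi_adj)
    also have "\<dots> = (\<Sum>r<n. cnj (f i $ r) * (\<pi> c * F j) $$ (r,0))"
      unfolding mult_mat_index[OF adj_carrier[OF F] mult_carrier_mat[OF pc F] n_pos n_pos]
      using n_pos by (intro sum.cong) (auto simp: F_def)
    also have "\<dots> = (\<Sum>r<n. (\<pi> c *\<^sub>v f j) $ r * cnj (f i $ r))"
    proof (intro sum.cong refl)
      fix r assume "r \<in> {..<n}"
      then have r: "r < n" by simp
      have "(\<pi> c * F j) $$ (r,0) = (\<Sum>s<n. \<pi> c $$ (r,s) * f j $ s)"
        unfolding mult_mat_index[OF pc F r n_pos] using n_pos by (intro sum.cong) (auto simp: F_def)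
      also have "\<dots> = (\<pi> c *\<^sub>v f j) $ r" by (rule mult_mat_vec_index[OF pc fc[OF ij(2)] r, symmetric])
      finally show "cnj (f i $ r) * (\<pi> c * F j) $$ (r,0) = (\<pi> c *\<^sub>v f j) $ r * cnj (f i $ r)" by simp
    qed
    also have "\<dots> = ip (\<pi> c *\<^sub>v f j) (f i)" using fc[OF ij(1)] by (simp add: ip_def)
    finally show ?thesis .
  qed
  have "ip (e i) (e j) = (if i = j then 1 else 0)" if "i < n" "j < n" for i j
    using form[OF cstar_gen.one that(2,1)] e[of i] fc[OF that(1)] f that by (simp add: pi_one orthonormal_family_def)
  then have "orthonormal_family m n e" using e by (auto simp: orthonormal_family_def)
  then show ?thesis using form by blast
qed

text \<open>The copy is completed to a basis of the whole space. Elements of the algebra act on the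
  copy with the norms of their images, so Parseval leaves no component outside; closure under
  adjoints gives invariance of the complement.\<close>

lemma exists_reducing_copy:
  assumes f: "orthonormal_family n n f"
  shows "\<exists>e. orthonormal_family m m e \<and> n \<le> m \<and> (\<forall>c\<in>B. \<forall>i<m. \<forall>j<n.
    ip (c *\<^sub>v e j) (e i) = (if i < n then ip (\<pi> c *\<^sub>v f j) (f i) else 0) \<and>
    (n \<le> i \<longrightarrow> ip (c *\<^sub>v e i) (e j) = 0))"
proof -
  obtain e0 where e0: "orthonormal_family m n e0" and
    form0: "\<forall>c\<in>B. \<forall>i<n. \<forall>j<n. ip (c *\<^sub>v e0 j) (e0 i) = ip (\<pi> c *\<^sub>v f j) (f i)"
    using exists_copy[OF f] by blast
  obtain e where e: "orthonormal_family m m e" and ee: "\<forall>i<n. e i = e0 i" using orthonormal_complete[OF e0] by blast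
  have nm: "n \<le> m" by (rule orthonormal_card_le[OF e0])
  have form: "ip (c *\<^sub>v e j) (e i) = ip (\<pi> c *\<^sub>v f j) (f i)" if "c \<in> B" "i < n" "j < n" for c i j
    using form0 ee that by simp
  have ec: "e i \<in> carrier_vec m" if "i < m" for i using e that by (auto simp: orthonormal_family_def)
  have fc: "f i \<in> carrier_vec n" if "i < n" for i using f that by (auto simp: orthonormal_family_def)
  have off: "ip (c *\<^sub>v e j) (e i) = 0" if c: "c \<in> B" and j: "j < n" and i: "n \<le> i" "i < m" for c i j
  proof -
    have cc: "c \<in> carrier_mat m m" and pc: "\<pi> c \<in> carrier_mat n n" using c B_carrier pi_carrier by auto
    have ej: "e j \<in> carrier_vec m" using ec j nm by simp
    have cec: "c *\<^sub>v e j \<in> carrier_vec m" and pfc: "\<pi> c *\<^sub>v f j \<in> carrier_vec n"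
      using cc ej pc fc[OF j] by auto
    have acc: "adj c * c \<in> B" using c B_intros by auto
    \<comment> \<open>The norm of \<open>c *\<^sub>v e j\<close> is computed from the form of
      \<open>adj c * c\<close>, which again belongs to the algebra.\<close>
    have "ip (c *\<^sub>v e j) (c *\<^sub>v e j) = ip ((adj c * c) *\<^sub>v e j) (e j)"
      using ip_adj[OF adj_carrier[OF cc] cec ej] assoc_mult_mat_vec[OF adj_carrier[OF cc] cc ej] by simp
    also have "\<dots> = ip ((adj (\<pi> c) * \<pi> c) *\<^sub>v f j) (f j)"
      using form[OF acc j j] c B_intros by (simp add: pi_mult pi_adj)
    also have "\<dots> = ip (\<pi> c *\<^sub>v f j) (\<pi> c *\<^sub>v f j)"
      using ip_adj[OF adj_carrier[OF pc] pfc fc[OF j]] assoc_mult_mat_vec[OF adj_carrier[OF pc] pc fc[OF j]] by simp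
    finally have "(vnorm (c *\<^sub>v e j))\<^sup>2 = (vnorm (\<pi> c *\<^sub>v f j))\<^sup>2" by (simp add: vnorm_square)
    then have "(\<Sum>k<m. (cmod (ip (c *\<^sub>v e j) (e k)))\<^sup>2) = (\<Sum>k<n. (cmod (ip (\<pi> c *\<^sub>v f j) (f k)))\<^sup>2)"
      by (simp add: parseval[OF e cec] parseval[OF f pfc])
    also have "\<dots> = (\<Sum>k<n. (cmod (ip (c *\<^sub>v e j) (e k)))\<^sup>2)" using form[OF c _ j] by simp
    finally have eq: "(\<Sum>k<m. (cmod (ip (c *\<^sub>v e j) (e k)))\<^sup>2) = (\<Sum>k<n. (cmod (ip (c *\<^sub>v e j) (e k)))\<^sup>2)" .
    have "(cmod (ip (c *\<^sub>v e j) (e i)))\<^sup>2 + (\<Sum>k<n. (cmod (ip (c *\<^sub>v e j) (e k)))\<^sup>2) \<le> (\<Sum>k<m. (cmod (ip (c *\<^sub>v e j) (e k)))\<^sup>2)"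
      using sum_mono2[of "{..<m}" "insert i {..<n}" "\<lambda>k. (cmod (ip (c *\<^sub>v e j) (e k)))\<^sup>2"] i nm by auto
    then show ?thesis using eq by simp
  qed
  have off': "ip (c *\<^sub>v e i) (e j) = 0" if c: "c \<in> B" and j: "j < n" and i: "n \<le> i" "i < m" for c i j
  proof -
    have cc: "c \<in> carrier_mat m m" using c B_carrier by auto
    have ej: "e j \<in> carrier_vec m" "e i \<in> carrier_vec m" using ec i j nm by auto
    have aej: "adj c *\<^sub>v e j \<in> carrier_vec m" using cc ej by (auto intro: mult_mat_vec_carrier)
    have "ip (c *\<^sub>v e i) (e j) = ip (e i) (adj c *\<^sub>v e j)" by (rule ip_adj[OF cc ej(2,1)])
    also have "\<dots> = cnj (ip (adj c *\<^sub>v e j) (e i))" by (rule ip_cnj[OF aej ej(2), symmetric])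
    also have "\<dots> = 0" using off[OF _ j i, of "adj c"] c B_intros by simp
    finally show ?thesis .
  qed
  show ?thesis using e nm form off off' by (intro exI[of _ e]) auto
qed

end

section \<open>Dimension bound and decomposition of the isometry\<close>

theorem theorem6p1:
  fixes n m :: nat and \<phi> :: "complex mat \<Rightarrow> complex mat"
  assumes unital_lin: "unital_linear_on (toeplitz_alg n) n m \<phi>"
    and isom: "\<forall>X\<in>toeplitz_alg n. opnorm (\<phi> X) = opnorm X"
  shows "n \<le> m \<and>
    (cstar_envelope_iso_Mn (\<phi> ` toeplitz_alg n) m n \<longrightarrow>
      (\<exists>U l \<psi>. unitary_mat m U \<and> 0 < l \<and> l * n \<le> m \<and>
         unital_linear_on (toeplitz_alg n) n (m - l * n) \<psi> \<and>
         (\<forall>X\<in>toeplitz_alg n. opnorm (\<psi> X) \<le> opnorm X) \<and>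
         (\<forall>X\<in>toeplitz_alg n.
            \<phi> X = U * diag_block_mat (replicate l X @ [\<psi> X]) * adj U)))"
proof (cases "n = 0")
  \<comment> \<open>For \<open>n = 0\<close> all source matrices are empty. The isometry forces the
    identity of size \<open>m\<close> to have norm 0, hence \<open>m = 0\<close>, and every equation
    is between empty matrices.\<close>
  case True
  have X0: "X \<in> carrier_mat 0 0" if "X \<in> toeplitz_alg n" for X
    using that True by (auto simp: toeplitz_alg_eq)
  have one: "1\<^sub>m 0 \<in> toeplitz_alg n" using True toep_one[of 0] unfolding toeplitz_alg_eq by (metis rangeI)
  have "opnorm (1\<^sub>m m) = opnorm (1\<^sub>m 0)"
    using isom one unital_lin True by (metis unital_linear_on_def)
  also have "\<dots> \<le> 0" by (intro opnorm_le[of _ 0 0]) (auto simp: vnorm_def)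
  finally have op: "opnorm (1\<^sub>m m) \<le> 0" .
  have m: "m = 0"
  proof (rule ccontr)
    assume "m \<noteq> 0"
    then have "vnorm (unit_vec m 0) = 1"
      by (simp add: vnorm_def unit_vec_def if_distrib[of cmod] if_distrib[of "\<lambda>x. x\<^sup>2"] cong: if_cong)
    then show False using vnorm_mult_le_opnorm[of "1\<^sub>m m" m m "unit_vec m 0"] op by simp
  qed
  have "\<phi> X = 1\<^sub>m 0 * diag_block_mat (replicate 1 X @ [X]) * adj (1\<^sub>m 0)" if "X \<in> toeplitz_alg n" for X
  proof -
    have "\<phi> X \<in> carrier_mat 0 0" using unital_lin that m by (auto simp: unital_linear_on_def)
    then show ?thesis by (intro eq_matI) auto
  qed
  then have "unitary_mat m (1\<^sub>m 0) \<and> 0 < (1::nat) \<and> 1 * n \<le> m \<and>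
         unital_linear_on (toeplitz_alg n) n (m - 1 * n) (\<lambda>X. X) \<and>
         (\<forall>X\<in>toeplitz_alg n. opnorm X \<le> opnorm X) \<and>
         (\<forall>X\<in>toeplitz_alg n. \<phi> X = 1\<^sub>m 0 * diag_block_mat (replicate 1 X @ [X]) * adj (1\<^sub>m 0))"
    using True m X0 by (auto simp: unitary_mat_def unital_linear_on_def)
  then show ?thesis using True by blast
next
  case False
  interpret toeplitz_isometry n m \<phi>
    using False unital_lin isom by unfold_locales auto
  show ?thesis
  proof (intro conjI impI)
    show "n \<le> m" by (rule dim_le)
    let ?A = "toeplitz_alg n"
    assume env: "cstar_envelope_iso_Mn (\<phi> ` ?A) m n"
    have phiX: "\<phi> X \<in> carrier_mat m m" if "X \<in> ?A" for X using unital_lin that by (auto simp: unital_linear_on_def)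
    obtain \<iota> where \<iota>: "unital_linear_on (\<phi> ` ?A) m n \<iota>" "complete_isometry_on (\<phi> ` ?A) m n \<iota>"
      and univ: "\<And>k \<kappa>. unital_linear_on (\<phi> ` ?A) m k \<kappa> \<Longrightarrow> complete_isometry_on (\<phi> ` ?A) m k \<kappa> \<Longrightarrow>
             (\<exists>\<pi>. star_hom_onto (cstar_gen k (\<kappa> ` \<phi> ` ?A)) k n \<pi> \<and> (\<forall>X\<in>\<phi> ` ?A. \<pi> (\<kappa> X) = \<iota> X))"
      using env unfolding cstar_envelope_iso_Mn_def by blast
    \<comment> \<open>The universal property is tested against the inclusion of the image into its
      own matrix algebra.\<close>
    have "unital_linear_on (\<phi> ` ?A) m m (\<lambda>X. X)" using phiX by (auto simp: unital_linear_on_def)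
    moreover have "complete_isometry_on (\<phi> ` ?A) m m (\<lambda>X. X)" by (simp add: complete_isometry_on_def)
    ultimately obtain \<pi> where \<pi>: "star_hom_onto (cstar_gen m (\<phi> ` ?A)) m n \<pi>" and \<pi>\<iota>: "\<And>X. X \<in> ?A \<Longrightarrow> \<pi> (\<phi> X) = \<iota> (\<phi> X)"
      using univ[of m "\<lambda>X. X"] by auto
    interpret C: cstar_onto "\<phi> ` ?A" m n \<pi>
      using False phiX \<pi> by unfold_locales auto
    have block1: "block_mat d 1 (\<lambda>i j. M) = M" if "M \<in> carrier_mat d d" for M d
      using that by (intro eq_matI) (auto simp: block_mat_def)
    \<comment> \<open>A complete isometry is isometric, by blocks of size 1. So the composition is a
      unital isometry into matrices of the original size, and the equal-dimension case provides a
      shift basis.\<close>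
    interpret R: toeplitz_isometry n n "\<lambda>X. \<iota> (\<phi> X)"
    proof
      show "0 < n" using False by simp
      show "unital_linear_on ?A n n (\<lambda>X. \<iota> (\<phi> X))"
        using unital_lin \<iota>(1) by (auto simp: unital_linear_on_def)
      fix X assume X: "X \<in> ?A"
      have "opnorm (block_mat n 1 (\<lambda>i j. \<iota> (\<phi> X))) = opnorm (block_mat m 1 (\<lambda>i j. \<phi> X))"
        using \<iota>(2) X by (auto simp: complete_isometry_on_def)
      moreover have "\<iota> (\<phi> X) \<in> carrier_mat n n" using \<iota>(1) X by (auto simp: unital_linear_on_def)
      ultimately show "opnorm (\<iota> (\<phi> X)) = opnorm X"
        using block1 phiX[OF X] isom X by simp
    qed
    obtain f where f: "orthonormal_family n n f" and fX: "\<And>a i j. i < n \<Longrightarrow> j < n \<Longrightarrow> ip (\<iota> (\<phi> (toep n a)) *\<^sub>v f j) (f i) = toep n a $$ (i,j)"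
      using R.exists_shift_basis by blast
    obtain e where e: "orthonormal_family m m e" and nm: "n \<le> m" and form: "\<And>c i j. c \<in> C.B \<Longrightarrow> i < m \<Longrightarrow> j < n \<Longrightarrow>
        ip (c *\<^sub>v e j) (e i) = (if i < n then ip (\<pi> c *\<^sub>v f j) (f i) else 0) \<and> (n \<le> i \<longrightarrow> ip (c *\<^sub>v e i) (e j) = 0)"
      using C.exists_reducing_copy[OF f] by blast
    define U where "U = mat_of_family m m e"
    have U: "unitary_mat m U" "U \<in> carrier_mat m m" using orthonormal_unitary[OF e] by (auto simp: U_def)
    \<comment> \<open>The basis vectors after the first \<open>n\<close>; they span the complement
      of the copy, to which \<open>\<psi>\<close> compresses \<open>\<phi>\<close>.\<close>
    define g where "g i = e (i + n)" for i
    have g: "orthonormal_family m (m - n) g" using e nm by (auto simp: orthonormal_family_def g_def)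
    define R where "R = mat_of_family m (m - n) g"
    have Rc: "R \<in> carrier_mat m (m - n)" "adj R \<in> carrier_mat (m - n) m" by (auto simp: R_def)
    have RR: "adj R * R = 1\<^sub>m (m - n)" unfolding R_def by (rule adj_mat_of_family_self[OF g])
    define \<psi> where "\<psi> X = adj R * (\<phi> X * R)" for X
    have psi_c: "\<psi> X \<in> carrier_mat (m - n) (m - n)" if "X \<in> ?A" for X
      unfolding \<psi>_def by (rule mult_carrier_mat[OF Rc(2) mult_carrier_mat[OF phiX[OF that] Rc(1)]])
    have psi: "unital_linear_on ?A n (m - n) \<psi>"
      unfolding unital_linear_on_def
    proof (intro conjI ballI allI)
      show "\<psi> (1\<^sub>m n) = 1\<^sub>m (m - n)"
        using unital_lin RR Rc by (simp add: \<psi>_def unital_linear_on_def)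
      fix X assume X: "X \<in> ?A"
      show "\<psi> X \<in> carrier_mat (m - n) (m - n)" by (rule psi_c[OF X])
      fix c
      have "\<phi> (c \<cdot>\<^sub>m X) = c \<cdot>\<^sub>m \<phi> X" using unital_lin X by (simp add: unital_linear_on_def)
      then show "\<psi> (c \<cdot>\<^sub>m X) = c \<cdot>\<^sub>m \<psi> X"
        using phiX[OF X] Rc by (simp add: \<psi>_def mult_smult_assoc_mat[of _ m m _ "m - n"] mult_smult_distrib[of _ "m - n" m _ "m - n"])
    next
      fix X Y assume X: "X \<in> ?A" "Y \<in> ?A"
      have "\<phi> (X + Y) = \<phi> X + \<phi> Y" using unital_lin X by (simp add: unital_linear_on_def)
      then show "\<psi> (X + Y) = \<psi> X + \<psi> Y"
        using phiX[OF X(1)] phiX[OF X(2)] Rc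
        by (simp add: \<psi>_def add_mult_distrib_mat[of _ m m _ _ "m - n"] mult_add_distrib_mat[of _ "m - n" m _ "m - n"])
    qed
    have contr: "opnorm (\<psi> X) \<le> opnorm X" if "X \<in> ?A" for X
      using opnorm_compression_le[OF g phiX[OF that]] isom that by (simp add: \<psi>_def R_def)
    have dec: "\<phi> X = U * diag_block_mat (replicate 1 X @ [\<psi> X]) * adj U" if X: "X \<in> ?A" for X
    proof -
      obtain a where a: "X = toep n a" using X by (auto simp: toeplitz_alg_eq)
      have XB: "\<phi> X \<in> C.B" using X by (auto intro: cstar_gen.gen)
      have Xc: "X \<in> carrier_mat n n" by (simp add: a)
      have D: "diag_block_mat (replicate 1 X @ [\<psi> X]) = four_block_mat X (0\<^sub>m n (m - n)) (0\<^sub>m (m - n) n) (\<psi> X)"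
      proof -
        have "diag_block_mat (replicate 1 X @ [\<psi> X]) = diag_block_mat [X, \<psi> X]" by simp
        also have "\<dots> = four_block_mat X (0\<^sub>m n (m - n)) (0\<^sub>m (m - n) n) (\<psi> X)"
          unfolding diag_block_mat.simps(2)[of X "[\<psi> X]"] diag_block_mat_singleton Let_def
          using Xc psi_c[OF X] by auto
        finally show ?thesis .
      qed
      have ec: "e i \<in> carrier_vec m" if "i < m" for i using e that by (auto simp: orthonormal_family_def)
      have gc: "g i \<in> carrier_vec m" if "i < m - n" for i using g that by (auto simp: orthonormal_family_def)
      \<comment> \<open>In the basis \<open>e\<close> the leading block is \<open>X\<close> by the
        choice of \<open>f\<close>, both off-diagonal blocks vanish by reduction, and the last block
        is \<open>\<psi> X\<close> by definition.\<close>
      have "adj U * (\<phi> X * U) = diag_block_mat (replicate 1 X @ [\<psi> X])"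
        unfolding D
      proof (rule eq_matI)
        let ?D = "four_block_mat X (0\<^sub>m n (m - n)) (0\<^sub>m (m - n) n) (\<psi> X)"
        fix i j assume "i < dim_row ?D" "j < dim_col ?D"
        then have ij: "i < m" "j < m" using Xc psi_c[OF X] nm by auto
        have l: "(adj U * (\<phi> X * U)) $$ (i,j) = ip (\<phi> X *\<^sub>v e j) (e i)"
          unfolding U_def by (rule adj_mat_of_family_mult[OF ec phiX[OF X] ij])
        have d: "?D $$ (i,j) = (if i < n then if j < n then X $$ (i,j) else 0 else if j < n then 0 else \<psi> X $$ (i - n, j - n))"
          using ij nm carrier_matD[OF Xc] carrier_matD[OF psi_c[OF X]] by (simp add: index_mat_four_block(1))
        have r: "\<psi> X $$ (i - n, j - n) = ip (\<phi> X *\<^sub>v e j) (e i)" if "n \<le> i" "n \<le> j"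
          using adj_mat_of_family_mult[of "m - n" g m "\<phi> X" "i - n" "j - n", OF gc phiX[OF X]] that ij
          by (simp add: \<psi>_def R_def g_def)
        show "(adj U * (\<phi> X * U)) $$ (i,j) = ?D $$ (i,j)"
          unfolding l d using ij form[OF XB, of i j] form[OF XB, of j i] fX[of i j a] \<pi>\<iota>[OF X] r a
          by (cases "i < n"; cases "j < n") auto
      qed (use U Xc psi_c[OF X] nm in auto)
      moreover have "U * (adj U * (\<phi> X * U)) = \<phi> X * U"
        using U phiX[OF X] assoc_mult_mat[of U m m "adj U" m "\<phi> X * U" m] by (auto simp: unitary_mat_def)
      ultimately have "U * diag_block_mat (replicate 1 X @ [\<psi> X]) * adj U = \<phi> X * U * adj U" by simp
      also have "\<dots> = \<phi> X" by (rule unitary_mult_cancel[OF U(1) phiX[OF X]])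
      finally show ?thesis by simp
    qed
    show "\<exists>U l \<psi>. unitary_mat m U \<and> 0 < l \<and> l * n \<le> m \<and>
         unital_linear_on ?A n (m - l * n) \<psi> \<and>
         (\<forall>X\<in>?A. opnorm (\<psi> X) \<le> opnorm X) \<and>
         (\<forall>X\<in>?A. \<phi> X = U * diag_block_mat (replicate l X @ [\<psi> X]) * adj U)"
      \<comment> \<open>One copy is split off, so \<open>l\<close> is 1.\<close>
      by (rule exI[of _ U], rule exI[of _ "1::nat"], rule exI[of _ \<psi>]) (use U nm psi contr dec in auto)
  qed
qed

end
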